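(* Let $K\subset\mathbb R^2$ be a triangle and let $$\boldsymbol{\Sigma}(K):=\{\boldsymbol\tau\in\mathbb P_3(K;\mathbb S):\ \operatorname{div}\boldsymbol\tau\in\mathbb P_1(K;\mathbb R^2),\ (\boldsymbol t^{\intercal}\boldsymbol\tau\boldsymbol n)|_e\in\mathbb P_2(e)\ \text{ for every edge } e \text{ of } K\}.$$ Then the following degrees of freedom (DoFs) are unisolvent for $\boldsymbol\Sigma(K)$: (a) $\boldsymbol\tau(\mathtt v)$ for each vertex $\mathtt v$ of $K$; (b) $(\boldsymbol n^{\intercal}\boldsymbol\tau\boldsymbol n,q)_e$ for $q\in\mathbb P_1(e)$ and each edge $e$ of $K$; (c) $(\boldsymbol t^{\intercal}\boldsymbol\tau\boldsymbol n,q)_e$ for $q\in\mathbb P_0(e)$ and each edge $e$ of $K$; (d) $(\boldsymbol\tau,\boldsymbol q)_K$ for $\boldsymbol q\in\mathbb P_0(K;\mathbb S)$.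
   Context: $\mathbb S$ is the space of symmetric $2\times2$ real matrices; $\mathbb P_k(D)$ is the space of polynomials of total degree at most $k$ on $D$, and $\mathbb P_k(D;\mathbb X)=\mathbb P_k(D)\otimes\mathbb X$. The divergence of a matrix field is taken row-wise. For an edge $e$, $\boldsymbol n$ and $\boldsymbol t$ are a unit normal and a unit tangent vector of $e$. $(\cdot,\cdot)_D$ is the $L^2(D)$ inner product. "Unisolvent" means: the linear functionals obtained by letting the test functions run over bases of the indicated test spaces (and, at the vertices, taking the three independent entries of $\boldsymbol\tau$) form a basis of the dual space of $\boldsymbol\Sigma(K)$; i.e. their number equals $\dim\boldsymbol\Sigma(K)$ and $\boldsymbol\tau=0$ whenever they all vanish on $\boldsymbol\tau\in\boldsymbol\Sigma(K)$. *)

theory Defs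
  imports "HOL-Analysis.Analysis" "HOL-Library.Function_Algebras"
begin

text \<open>Functions into a real vector space form a real vector space pointwise; this makes
  \<^const>\<open>span\<close> and \<^const>\<open>independent\<close> available for spaces of
  functions and for dual spaces.\<close>

instantiation "fun" :: (type, real_vector) real_vector
begin

definition "scaleR r f = (\<lambda>x. r *\<^sub>R f x)"

instance
  by standard (simp_all add: scaleR_fun_def fun_eq_iff scaleR_add_right scaleR_add_left)

end

definition basis_of :: "'v::real_vector set \<Rightarrow> 'v set \<Rightarrow> bool" where
  "basis_of B V \<longleftrightarrow> independent B \<and> span B = V"

text \<open>A function on a set \<open>D\<close> is encoded as a total function vanishing outside
  \<open>D\<close>, so that two functions on \<open>D\<close> are equal iff they agree on
  \<open>D\<close>.\<close>

definition restr :: "'a set \<Rightarrow> ('a \<Rightarrow> 'b::zero) \<Rightarrow> 'a \<Rightarrow> 'b" where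
  "restr D f = (\<lambda>x. if x \<in> D then f x else 0)"

text \<open>The space $P_k(D; X) = P_k(D) \otimes X$, i.e. restrictions to \<open>D\<close> of
  polynomials of total degree at most \<open>k\<close> with coefficients in the vector space
  \<open>X\<close>.  If \<open>D\<close> is a line segment, these are the polynomials of degree at
  most \<open>k\<close> in the arc length of \<open>D\<close>.\<close>

definition poly_space :: "nat \<Rightarrow> (real^2) set \<Rightarrow> 'x::real_vector set \<Rightarrow> (real^2 \<Rightarrow> 'x) set" where
  "poly_space k D X = {restr D (\<lambda>x. \<Sum>i\<le>k. \<Sum>j\<le>k - i. (x$1 ^ i * x$2 ^ j) *\<^sub>R c i j) | c.
     \<forall>i j. c i j \<in> X}"

definition sym_mats :: "(real^2^2) set" where
  "sym_mats = {A. transpose A = A}"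

text \<open>The derivative is taken within \<open>D\<close>, so that the divergence of a field
  given only on a triangle \<open>D\<close> also makes sense on the boundary.\<close>

definition row_div :: "(real^2) set \<Rightarrow> (real^2 \<Rightarrow> real^2^2) \<Rightarrow> real^2 \<Rightarrow> real^2" where
  "row_div D \<tau> = restr D (\<lambda>x. \<chi> i. \<Sum>j\<in>UNIV.
     frechet_derivative \<tau> (at x within D) (axis j 1) $ i $ j)"

definition unit_tangent :: "(real^2) set \<Rightarrow> real^2 \<Rightarrow> bool" where
  "unit_tangent e t \<longleftrightarrow> norm t = 1 \<and> t \<in> span {x - y | x y. x \<in> e \<and> y \<in> e}"

definition unit_normal :: "(real^2) set \<Rightarrow> real^2 \<Rightarrow> bool" where
  "unit_normal e n \<longleftrightarrow> norm n = 1 \<and> (\<forall>x\<in>e. \<forall>y\<in>e. n \<bullet> (x - y) = 0)"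

definition Sigma_space :: "(real^2) set \<Rightarrow> (real^2 \<Rightarrow> real^2^2) set" where
  "Sigma_space K = {\<tau> \<in> poly_space 3 K sym_mats.
     row_div K \<tau> \<in> poly_space 1 K UNIV \<and>
     (\<forall>e t n. e edge_of K \<longrightarrow> unit_tangent e t \<longrightarrow> unit_normal e n \<longrightarrow>
        restr e (\<lambda>x. t \<bullet> (\<tau> x *v n)) \<in> poly_space 2 e UNIV)}"

text \<open>Arc length integral over a segment; the value does not depend on the chosen order of
  the endpoints.\<close>

definition edge_integral :: "(real^2) set \<Rightarrow> (real^2 \<Rightarrow> real) \<Rightarrow> real" where
  "edge_integral e f = (let (a, b) = (SOME (a, b). e = closed_segment a b) in
     dist a b * integral {0..1} (\<lambda>s. f (a + s *\<^sub>R (b - a))))"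

datatype dof =
    Vertex_value "real^2" "2 \<times> 2"
  | Edge_nn "(real^2) set" "real^2 \<Rightarrow> real"
  | Edge_tn "(real^2) set" "real^2 \<Rightarrow> real"
  | Interior "real^2 \<Rightarrow> real^2^2"

text \<open>The functional belonging to a degree of freedom, for chosen normals \<open>n e\<close>
  and tangents \<open>t e\<close> of the edges.  The inner product on \<^typ>\<open>real^2^2\<close> is
  the Frobenius one.\<close>

fun dof_eval :: "(real^2) set \<Rightarrow> ((real^2) set \<Rightarrow> real^2) \<Rightarrow> ((real^2) set \<Rightarrow> real^2) \<Rightarrow>
    dof \<Rightarrow> (real^2 \<Rightarrow> real^2^2) \<Rightarrow> real" where
  "dof_eval K n t (Vertex_value v (i, j)) \<tau> = \<tau> v $ i $ j"
| "dof_eval K n t (Edge_nn e q) \<tau> = edge_integral e (\<lambda>x. (n e \<bullet> (\<tau> x *v n e)) * q x)"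
| "dof_eval K n t (Edge_tn e q) \<tau> = edge_integral e (\<lambda>x. (t e \<bullet> (\<tau> x *v n e)) * q x)"
| "dof_eval K n t (Interior q) \<tau> = integral K (\<lambda>x. \<tau> x \<bullet> q x)"

text \<open>The degrees of freedom obtained from sets \<open>B1 e\<close>, \<open>B0 e\<close>,
  \<open>BK\<close> of test functions.  The entry (2,1) of a symmetric matrix is redundant.\<close>

definition dofs :: "(real^2) set \<Rightarrow> ((real^2) set \<Rightarrow> (real^2 \<Rightarrow> real) set) \<Rightarrow>
    ((real^2) set \<Rightarrow> (real^2 \<Rightarrow> real) set) \<Rightarrow> (real^2 \<Rightarrow> real^2^2) set \<Rightarrow> dof set" where
  "dofs K B1 B0 BK =
     {Vertex_value v ij | v ij. v extreme_point_of K \<and> ij \<in> {(1, 1), (1, 2), (2, 2)}} \<union>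
     {Edge_nn e q | e q. e edge_of K \<and> q \<in> B1 e} \<union>
     {Edge_tn e q | e q. e edge_of K \<and> q \<in> B0 e} \<union>
     {Interior q | q. q \<in> BK}"

definition dual_space :: "'v::real_vector set \<Rightarrow> ('v \<Rightarrow> real) set" where
  "dual_space V = {\<phi>. (\<forall>x\<in>V. \<forall>y\<in>V. \<phi> (x + y) = \<phi> x + \<phi> y) \<and>
     (\<forall>x\<in>V. \<forall>r. \<phi> (r *\<^sub>R x) = r * \<phi> x) \<and> (\<forall>x. x \<notin> V \<longrightarrow> \<phi> x = 0)}"

text \<open>The restrictions to \<open>V\<close> of the functionals \<open>l i\<close>, \<open>i \<in> I\<close>,
  are pairwise distinct and form a basis of the dual space of \<open>V\<close>.\<close>

definition unisolvent :: "'v::real_vector set \<Rightarrow> 'i set \<Rightarrow> ('i \<Rightarrow> 'v \<Rightarrow> real) \<Rightarrow> bool" where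
  "unisolvent V I l \<longleftrightarrow> inj_on (\<lambda>i. restr V (l i)) I \<and>
     basis_of ((\<lambda>i. restr V (l i)) ` I) (dual_space V)"

end

theory Submission
  imports Defs
begin

text \<open>Let \<open>a\<close>, \<open>b\<close>, \<open>c\<close> be the vertices of the triangle.  The matrices
  $uu^T$, where \<open>u\<close> runs over the edge vectors $c - b$, $a - c$, $b - a$, form a basis of
  the symmetric matrices, so a cubic symmetric field has three scalar cubic coefficients
  \<open>p\<close>, \<open>q\<close>, \<open>r\<close>, each written as a homogeneous cubic in barycentric
  coordinates: 30 parameters in total.  The two conditions defining the space amount to nine linear
  constraints on them, and there are at most 21 degrees of freedom.  Hence it suffices that
  constraints and degrees of freedom together separate the parameters; the dimension of the space and
  unisolvence then come out simultaneously.

  On the edge from \<open>a\<close> to \<open>b\<close> the coefficient \<open>r\<close> contributes nothing to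
  $\tau n$.  The normal component is a multiple of $p + q$, a cubic vanishing at the endpoints and
  orthogonal to linear functions; the tangential component is a combination $\alpha p - \beta q$ with
  $\alpha + \beta \neq 0$, a quadratic that vanishes at the endpoints and has mean zero.  So
  \<open>p\<close> and \<open>q\<close> vanish on this edge; likewise for the other edges.  Each
  coefficient is then a product of two barycentric coordinates and a linear function, with zero mean
  by the interior degrees of freedom, and comparing coefficients in the divergence constraint leaves
  only zero.\<close>

section \<open>Dual families and unisolvence\<close>

text \<open>The basis \<open>outer u\<close> makes both constraints explicit. The row-wise
  divergence of f u u^T is (D_u f) u, and along an edge vector the barycentric coordinates change by
  0, 1 and -1. So the divergence constraint contains no lengths or angles; these enter the
  constraints only through \<open>edge_coeff\<close>. Nine is six plus three: the divergence has two
  quadratic coordinates, each affine iff its quadratic form vanishes in three directions, and each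
  edge contributes one leading coefficient. The bound 21 is 9 + 6 + 3 + 3. The sum \<alpha> +
  \<beta> is minus the squared edge length, hence nonzero for every shape of triangle. In the final
  comparison two unknowns per coefficient remain, against six equations. Their numerical
  coefficients are the same for every triangle, so only a fixed linear system has to be solved. The
  setting is invariant under the cyclic relabelling a -> b -> c -> a together with
  \<open>rot_cubic\<close>. Edge statements are therefore proved only for the edge from a to
  b.\<close>

lemma DIM_le_if_separating:
  fixes m :: "'a::euclidean_space \<Rightarrow> 'b::euclidean_space" and L :: "'i \<Rightarrow> 'a \<Rightarrow> real"
  assumes m: "linear m" and fin: "finite I" and L: "\<And>i. i \<in> I \<Longrightarrow> linear (L i)"
    and sep: "\<And>c. m c = 0 \<Longrightarrow> (\<And>i. i \<in> I \<Longrightarrow> L i c = 0) \<Longrightarrow> c = 0"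
  shows "DIM('a) \<le> DIM('b) + card I"
proof -
  define r where "r i = adjoint (L i) 1" for i
  have r: "L i c = c \<bullet> r i" if "i \<in> I" for i c
    using adjoint_works[OF L[OF that], of c 1] by (simp add: r_def)
  \<comment> \<open>This is L^T L, with the Riesz vectors \<open>r i\<close> as rows of L. The inner
    product of c and g c is the sum of the squares of the \<open>L i c\<close>, so g vanishes
    exactly on the common zeros, while its range lies in the span of at most \<open>card I\<close>
    vectors. It stands in for a coordinate space indexed by the set \<open>I\<close>.\<close>
  define g where "g c = (\<Sum>i\<in>I. L i c *\<^sub>R r i)" for c
  define f where "f c = (m c, g c)" for c
  have lg: "linear g"
    unfolding g_def using L by (intro linear_compose_sum ballI) (auto intro!: linearI simp: linear_add linear_scale algebra_simps)
  have lf: "linear f"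
    unfolding f_def by (intro linearI) (simp_all add: linear_add[OF m] linear_add[OF lg] linear_scale[OF m] linear_scale[OF lg])
  have "c = 0" if "f c = 0" for c
  proof (rule sep)
    show "m c = 0" using that by (simp add: f_def zero_prod_def)
    have "0 = c \<bullet> g c" using that by (simp add: f_def zero_prod_def)
    also have "\<dots> = (\<Sum>i\<in>I. (L i c)\<^sup>2)"
      by (simp add: g_def inner_sum_right r power2_eq_square)
    finally show "L i c = 0" if "i \<in> I" for i
      using sum_nonneg_eq_0_iff[OF fin, of "\<lambda>i. (L i c)\<^sup>2"] that by auto
  qed
  then have "inj f" using lf linear_injective_0 by blast
  then have "DIM('a) = dim (range f)" using dim_image_eq[OF lf, of UNIV] by simp
  also have "range f \<subseteq> (UNIV :: 'b set) \<times> span (r ` I)"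
    by (auto simp: f_def g_def intro: span_sum span_scale span_base)
  then have "dim (range f) \<le> dim ((UNIV :: 'b set) \<times> span (r ` I))" by (rule dim_subset)
  also have "\<dots> = DIM('b) + dim (r ` I)" by (subst dim_Times) (auto simp: dim_span)
  also have "\<dots> \<le> DIM('b) + card I"
    using dim_le_card'[of "r ` I"] fin card_image_le[OF fin, of r] by simp
  finally show ?thesis .
qed

lemma dual_family_if_separating:
  fixes m :: "'a::euclidean_space \<Rightarrow> 'b::euclidean_space" and L :: "'i \<Rightarrow> 'a \<Rightarrow> real"
  assumes m: "linear m" and fin: "finite I" and L: "\<And>i. i \<in> I \<Longrightarrow> linear (L i)"
    and sep: "\<And>c. m c = 0 \<Longrightarrow> (\<And>i. i \<in> I \<Longrightarrow> L i c = 0) \<Longrightarrow> c = 0"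
    and card: "DIM('b) + card I \<le> DIM('a)" and i: "i \<in> I"
  obtains c where "m c = 0" "\<And>j. j \<in> I \<Longrightarrow> L j c = (if j = i then 1 else 0)"
proof -
  have "\<exists>c. m c = 0 \<and> (\<forall>j\<in>I - {i}. L j c = 0) \<and> L i c \<noteq> 0"
  proof (rule ccontr)
    assume "\<not> ?thesis"
    then have "DIM('a) \<le> DIM('b) + card (I - {i})"
      using m fin L sep by (intro DIM_le_if_separating[where m = m and L = L]) auto
    moreover have "card (I - {i}) < card I" using fin i by (rule card_Diff1_less)
    ultimately show False using card by simp
  qed
  then obtain c where "m c = 0" "\<And>j. j \<in> I \<Longrightarrow> j \<noteq> i \<Longrightarrow> L j c = 0" "L i c \<noteq> 0" by auto
  then show thesis
    using that[of "(1 / L i c) *\<^sub>R c"] L i m by (auto simp: linear_scale)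
qed

lemma dual_space_0: "\<phi> \<in> dual_space V \<Longrightarrow> 0 \<in> V \<Longrightarrow> \<phi> 0 = 0"
  unfolding dual_space_def by clarsimp (metis mult_zero_left scaleR_zero_left)

lemma dual_space_sum:
  assumes "\<phi> \<in> dual_space V" "subspace V" "\<And>i. i \<in> I \<Longrightarrow> x i \<in> V"
  shows "\<phi> (\<Sum>i\<in>I. a i *\<^sub>R x i) = (\<Sum>i\<in>I. a i * \<phi> (x i))"
  using assms(3)
proof (induction I rule: infinite_finite_induct)
  case (insert i I)
  then show ?case using assms(1,2)
    by (auto simp: dual_space_def subspace_sum subspace_scale)
qed (use dual_space_0[OF assms(1)] subspace_0[OF assms(2)] in auto)

lemma subspace_dual_space: "subspace (dual_space V)"
  unfolding subspace_def dual_space_def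
  by (auto simp: plus_fun_def zero_fun_def scaleR_fun_def algebra_simps)

lemma sum_fun_apply: "(\<Sum>i\<in>I. f i) x = (\<Sum>i\<in>I. f i x)"
  by (induction I rule: infinite_finite_induct) auto

text \<open>The space \<open>V\<close> is given by parameters \<open>c\<close> subject to the linear
  constraint \<open>m c = 0\<close>; counting the functionals together with the constraints against
  the number of parameters makes it unnecessary to compute the dimension of \<open>V\<close>.\<close>

lemma unisolvent_if_separating:
  fixes m :: "'a::euclidean_space \<Rightarrow> 'b::euclidean_space" and \<Theta> :: "'a \<Rightarrow> 'v::real_vector"
  assumes m: "linear m" and fin: "finite I" and \<Theta>: "linear \<Theta>" and V: "V = \<Theta> ` {c. m c = 0}"
    and l: "\<And>i. i \<in> I \<Longrightarrow> linear (\<lambda>c. l i (\<Theta> c))"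
    and sep: "\<And>c. m c = 0 \<Longrightarrow> (\<And>i. i \<in> I \<Longrightarrow> l i (\<Theta> c) = 0) \<Longrightarrow> c = 0"
    and card: "DIM('b) + card I \<le> DIM('a)"
  shows "unisolvent V I l"
proof -
  have sub: "subspace V"
    unfolding V using m by (intro linear_subspace_image \<Theta> linear_subspace_kernel)
  have "\<forall>i\<in>I. \<exists>c. m c = 0 \<and> (\<forall>j\<in>I. l j (\<Theta> c) = (if j = i then 1 else 0))"
  proof
    fix i assume i: "i \<in> I"
    show "\<exists>c. m c = 0 \<and> (\<forall>j\<in>I. l j (\<Theta> c) = (if j = i then 1 else 0))"
      by (rule dual_family_if_separating[where m = m and L = "\<lambda>i c. l i (\<Theta> c)", OF m fin l sep card i]) auto
  qed
  then obtain d where d: "\<And>i. i \<in> I \<Longrightarrow> m (d i) = 0"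
      "\<And>i j. i \<in> I \<Longrightarrow> j \<in> I \<Longrightarrow> l j (\<Theta> (d i)) = (if j = i then 1 else 0)"
    by metis
  define R where "R i = restr V (l i)" for i
  have dV: "\<Theta> (d i) \<in> V" if "i \<in> I" for i using d that unfolding V by auto
  have Rd: "R j (\<Theta> (d i)) = (if j = i then 1 else 0)" if "i \<in> I" "j \<in> I" for i j
    using d dV that by (auto simp: R_def restr_def)
  have inj: "inj_on R I"
    by (rule inj_onI) (metis Rd zero_neq_one)
  have indep: "independent (R ` I)"
  proof (rule independent_if_scalars_zero)
    show "finite (R ` I)" using fin by simp
    fix a x assume a: "(\<Sum>x\<in>R ` I. a x *\<^sub>R x) = 0" and x: "x \<in> R ` I"
    from x obtain i where i: "i \<in> I" "x = R i" by auto
    have "0 = (\<Sum>x\<in>R ` I. a x *\<^sub>R x) (\<Theta> (d i))" using a by simp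
    also have "\<dots> = (\<Sum>j\<in>I. a (R j) * R j (\<Theta> (d i)))"
      by (simp add: sum.reindex[OF inj] sum_fun_apply scaleR_fun_def)
    also have "\<dots> = (\<Sum>j\<in>I. if j = i then a (R j) else 0)"
      using i by (intro sum.cong) (auto simp: Rd)
    also have "\<dots> = a x" using i fin by simp
    finally show "a x = 0" by simp
  qed
  have "R i \<in> dual_space V" if i: "i \<in> I" for i
  proof -
    have "l i (x + y) = l i x + l i y" if "x \<in> V" "y \<in> V" for x y
      using that linear_add[OF l[OF i]] linear_add[OF \<Theta>] unfolding V by auto
    moreover have "l i (r *\<^sub>R x) = r * l i x" if "x \<in> V" for r x
      using that linear_scale[OF l[OF i]] linear_scale[OF \<Theta>] unfolding V by auto
    ultimately show ?thesis using sub
      by (auto simp: dual_space_def R_def restr_def subspace_def)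
  qed
  then have "span (R ` I) \<subseteq> dual_space V"
    by (intro span_minimal subspace_dual_space) auto
  moreover have "\<phi> \<in> span (R ` I)" if \<phi>: "\<phi> \<in> dual_space V" for \<phi>
  proof -
    have "\<phi> = (\<Sum>i\<in>I. \<phi> (\<Theta> (d i)) *\<^sub>R R i)"
    proof
      fix x
      show "\<phi> x = (\<Sum>i\<in>I. \<phi> (\<Theta> (d i)) *\<^sub>R R i) x"
      proof (cases "x \<in> V")
        case False
        then have "\<phi> x = 0" "R i x = 0" for i using \<phi> by (auto simp: dual_space_def R_def restr_def)
        then show ?thesis by (simp add: sum_fun_apply scaleR_fun_def)
      next
        case True
        then obtain c where c: "m c = 0" "x = \<Theta> c" unfolding V by auto
        define c' where "c' = (\<Sum>i\<in>I. l i x *\<^sub>R d i)"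
        \<comment> \<open>Both c and c' satisfy the constraint and give the same functional values,
          so separation identifies them. Thus each x in \<open>V\<close> is expanded in the dual
          vectors, which is why the \<open>R i\<close> span the dual space.\<close>
        have "c - c' = 0"
        proof (rule sep)
          show "m (c - c') = 0"
            using c d by (simp add: c'_def linear_diff[OF m] linear_sum[OF m] linear_scale[OF m])
          fix j assume j: "j \<in> I"
          have "l j (\<Theta> (c - c')) = l j x - (\<Sum>i\<in>I. l i x * l j (\<Theta> (d i)))"
            by (simp add: c'_def c linear_diff[OF l[OF j]] linear_sum[OF l[OF j]] linear_scale[OF l[OF j]])
          also have "(\<Sum>i\<in>I. l i x * l j (\<Theta> (d i))) = (\<Sum>i\<in>I. if i = j then l i x else 0)"
            using d j by (intro sum.cong) auto
          finally show "l j (\<Theta> (c - c')) = 0" using j fin by simp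
        qed
        then have "x = \<Theta> c'" by (simp add: c)
        then have "x = (\<Sum>i\<in>I. l i x *\<^sub>R \<Theta> (d i))"
          by (simp add: c'_def linear_sum[OF \<Theta>] linear_scale[OF \<Theta>])
        then have "\<phi> x = \<phi> (\<Sum>i\<in>I. l i x *\<^sub>R \<Theta> (d i))" by (rule arg_cong)
        also have "\<dots> = (\<Sum>i\<in>I. l i x * \<phi> (\<Theta> (d i)))"
          by (rule dual_space_sum[OF \<phi> sub dV])
        finally have "\<phi> x = (\<Sum>i\<in>I. l i x * \<phi> (\<Theta> (d i)))" .
        then show ?thesis using True
          by (simp add: sum_fun_apply scaleR_fun_def R_def restr_def mult.commute)
      qed
    qed
    also have "\<dots> \<in> span (R ` I)" by (intro span_sum span_scale span_base) auto
    finally show ?thesis .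
  qed
  ultimately show ?thesis
    using indep inj unfolding unisolvent_def basis_of_def R_def by auto
qed

section \<open>Polynomial spaces\<close>

text \<open>Generic in the coordinate pair, so that Cartesian and barycentric coordinates share one
  theory; \<open>polyfun_trans\<close> changes between them.\<close>

definition polyfun :: "('a \<Rightarrow> real) \<Rightarrow> ('a \<Rightarrow> real) \<Rightarrow> nat \<Rightarrow> ('a \<Rightarrow> real) set" where
  "polyfun u v k = span {\<lambda>x. u x ^ i * v x ^ j | i j. i + j \<le> k}"

lemma polyfun_add: "f \<in> polyfun u v k \<Longrightarrow> g \<in> polyfun u v k \<Longrightarrow> (\<lambda>x. f x + g x) \<in> polyfun u v k"
  using span_add[of f _ g] by (simp add: polyfun_def plus_fun_def)

lemma polyfun_scale: "f \<in> polyfun u v k \<Longrightarrow> (\<lambda>x. c * f x) \<in> polyfun u v k"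
  using span_scale[of f _ c] by (simp add: polyfun_def scaleR_fun_def)

lemma polyfun_0: "(\<lambda>x. 0) \<in> polyfun u v k"
  unfolding polyfun_def zero_fun_def[symmetric] by (rule span_zero)

lemma polyfun_sum: "(\<And>i. i \<in> I \<Longrightarrow> f i \<in> polyfun u v k) \<Longrightarrow> (\<lambda>x. \<Sum>i\<in>I. f i x) \<in> polyfun u v k"
  by (induction I rule: infinite_finite_induct) (auto intro: polyfun_add polyfun_0)

lemma polyfun_monomial: "i + j \<le> k \<Longrightarrow> (\<lambda>x. u x ^ i * v x ^ j) \<in> polyfun u v k"
  unfolding polyfun_def by (intro span_base) auto

lemma polyfun_const: "(\<lambda>x. c) \<in> polyfun u v k"
  using polyfun_scale[OF polyfun_monomial[of 0 0 k u v], of c] by simp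

lemma polyfun_fst: "u \<in> polyfun u v (Suc k)"
  using polyfun_monomial[of 1 0 "Suc k" u v] by simp

lemma polyfun_snd: "v \<in> polyfun u v (Suc k)"
  using polyfun_monomial[of 0 1 "Suc k" u v] by simp

lemma polyfun_mono: "k \<le> l \<Longrightarrow> polyfun u v k \<subseteq> polyfun u v l"
  unfolding polyfun_def by (intro span_mono) (use order_trans in blast)

lemma polyfun_induct [consumes 1, case_names 0 add scale monomial]:
  assumes "f \<in> polyfun u v k" and "Q (\<lambda>x. 0)"
    and "\<And>f g. Q f \<Longrightarrow> Q g \<Longrightarrow> Q (\<lambda>x. f x + g x)" and "\<And>c f. Q f \<Longrightarrow> Q (\<lambda>x. c * f x)"
    and "\<And>i j. i + j \<le> k \<Longrightarrow> Q (\<lambda>x. u x ^ i * v x ^ j)"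
  shows "Q f"
proof -
  have "subspace {f. Q f}"
    using assms(2-4) by (auto simp: subspace_def zero_fun_def plus_fun_def scaleR_fun_def)
  then show ?thesis
    using span_induct[OF assms(1)[unfolded polyfun_def], of Q] assms(5) by blast
qed

lemma polyfun_mult:
  assumes f: "f \<in> polyfun u v k" and g: "g \<in> polyfun u v l"
  shows "(\<lambda>x. f x * g x) \<in> polyfun u v (k + l)"
  using f
proof (induction rule: polyfun_induct)
  case (monomial i j)
  show ?case using g
  proof (induction rule: polyfun_induct)
    case (monomial i' j')
    with \<open>i + j \<le> k\<close> show ?case
      using polyfun_monomial[of "i + i'" "j + j'" "k + l" u v] by (simp add: power_add mult_ac)
  next
    case (add f g)
    then show ?case using polyfun_add[OF add] by (simp add: distrib_left)
  next
    case (scale c f)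
    then show ?case using polyfun_scale[OF scale, of c] by (simp add: mult_ac)
  qed (simp add: polyfun_0)
next
  case (add f g)
  then show ?case using polyfun_add[OF add] by (simp add: distrib_right)
next
  case (scale c f)
  then show ?case using polyfun_scale[OF scale, of c] by (simp add: mult_ac)
qed (simp add: polyfun_0)

lemma polyfun_power: "f \<in> polyfun u v k \<Longrightarrow> (\<lambda>x. f x ^ n) \<in> polyfun u v (n * k)"
  by (induction n) (auto intro: polyfun_const polyfun_mult)

lemma polyfun_trans:
  assumes "u' \<in> polyfun u v 1" "v' \<in> polyfun u v 1" "f \<in> polyfun u' v' k"
  shows "f \<in> polyfun u v k"
  using assms(3)
proof (induction rule: polyfun_induct)
  case (monomial i j)
  have "(\<lambda>x. u' x ^ i * v' x ^ j) \<in> polyfun u v (i * 1 + j * 1)"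
    by (intro polyfun_mult polyfun_power assms)
  then show ?case using polyfun_mono[of "i + j" k u v] monomial by auto
qed (auto intro: polyfun_0 polyfun_add polyfun_scale)

lemma polyfun_iff:
  "f \<in> polyfun u v k \<longleftrightarrow> (\<exists>c. f = (\<lambda>x. \<Sum>i\<le>k. \<Sum>j\<le>k - i. c i j * (u x ^ i * v x ^ j)))"
proof
  assume "f \<in> polyfun u v k"
  then show "\<exists>c. f = (\<lambda>x. \<Sum>i\<le>k. \<Sum>j\<le>k - i. c i j * (u x ^ i * v x ^ j))"
  proof (induction rule: polyfun_induct)
    case 0
    show ?case by (rule exI[of _ "\<lambda>i j. 0"]) simp
  next
    case (add f g)
    then obtain c d where "f = (\<lambda>x. \<Sum>i\<le>k. \<Sum>j\<le>k - i. c i j * (u x ^ i * v x ^ j))"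
      "g = (\<lambda>x. \<Sum>i\<le>k. \<Sum>j\<le>k - i. d i j * (u x ^ i * v x ^ j))" by auto
    then show ?case
      by (intro exI[of _ "\<lambda>i j. c i j + d i j"]) (simp add: distrib_right sum.distrib)
  next
    case (scale c f)
    then obtain d where "f = (\<lambda>x. \<Sum>i\<le>k. \<Sum>j\<le>k - i. d i j * (u x ^ i * v x ^ j))" by auto
    then show ?case
      by (intro exI[of _ "\<lambda>i j. c * d i j"]) (simp add: sum_distrib_left mult_ac)
  next
    case (monomial i j)
    have "(\<Sum>i'\<le>k. \<Sum>j'\<le>k - i'. (if i' = i \<and> j' = j then 1 else 0) * (u x ^ i' * v x ^ j'))
        = u x ^ i * v x ^ j" for x
    proof -
      have "(\<Sum>i'\<le>k. \<Sum>j'\<le>k - i'. (if i' = i \<and> j' = j then 1 else 0) * (u x ^ i' * v x ^ j'))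
        = (\<Sum>i'\<le>k. if i' = i then \<Sum>j'\<le>k - i. if j' = j then u x ^ i * v x ^ j else 0 else 0)"
        by (intro sum.cong refl) (simp add: if_distrib[of "\<lambda>a. a * _"] cong: if_cong)
      then show ?thesis using monomial by simp
    qed
    then show ?case by (intro exI[of _ "\<lambda>i' j'. if i' = i \<and> j' = j then 1 else 0"]) simp
  qed
next
  assume "\<exists>c. f = (\<lambda>x. \<Sum>i\<le>k. \<Sum>j\<le>k - i. c i j * (u x ^ i * v x ^ j))"
  then show "f \<in> polyfun u v k"
    by (auto intro!: polyfun_sum polyfun_scale polyfun_monomial)
qed

abbreviation polyfun2 :: "nat \<Rightarrow> (real^2 \<Rightarrow> real) set" where
  "polyfun2 \<equiv> polyfun (\<lambda>x. x$1) (\<lambda>x. x$2)"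

text \<open>Passes from coefficients in \<open>X\<close> to scalar polynomials: each coefficient is
  expanded in the family \<open>T\<close>, and the sum over monomials is interchanged with the sum
  over \<open>T\<close>. The converse is \<open>poly_spaceI\<close>.\<close>

lemma poly_spaceE:
  assumes f: "f \<in> poly_space k D X" and X: "\<And>A. A \<in> X \<Longrightarrow> \<exists>a. A = (\<Sum>m\<in>M. a m *\<^sub>R T m)"
  obtains g where "\<And>m. g m \<in> polyfun2 k" "f = restr D (\<lambda>x. \<Sum>m\<in>M. g m x *\<^sub>R T m)"
proof -
  from f obtain c where c: "\<And>i j. c i j \<in> X"
    "f = restr D (\<lambda>x. \<Sum>i\<le>k. \<Sum>j\<le>k - i. (x$1 ^ i * x$2 ^ j) *\<^sub>R c i j)"
    unfolding poly_space_def by auto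
  have "\<forall>A\<in>X. \<exists>a. A = (\<Sum>m\<in>M. a m *\<^sub>R T m)" using X by blast
  then obtain a where a: "\<And>A. A \<in> X \<Longrightarrow> A = (\<Sum>m\<in>M. a A m *\<^sub>R T m)"
    by (subst (asm) bchoice_iff) blast
  define g where "g m x = (\<Sum>i\<le>k. \<Sum>j\<le>k - i. a (c i j) m * (x$1 ^ i * x$2 ^ j))" for m and x :: "real^2"
  have "(\<Sum>i\<le>k. \<Sum>j\<le>k - i. (x$1 ^ i * x$2 ^ j) *\<^sub>R c i j) = (\<Sum>m\<in>M. g m x *\<^sub>R T m)" for x
  proof -
    have "(\<Sum>i\<le>k. \<Sum>j\<le>k - i. (x$1 ^ i * x$2 ^ j) *\<^sub>R c i j)
        = (\<Sum>i\<le>k. \<Sum>j\<le>k - i. (x$1 ^ i * x$2 ^ j) *\<^sub>R (\<Sum>m\<in>M. a (c i j) m *\<^sub>R T m))"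
      by (intro sum.cong refl arg_cong2[where f = scaleR] a c(1))
    also have "\<dots> = (\<Sum>i\<le>k. \<Sum>m\<in>M. \<Sum>j\<le>k - i. (a (c i j) m * (x$1 ^ i * x$2 ^ j)) *\<^sub>R T m)"
      by (simp add: scaleR_sum_right mult.commute) (intro sum.cong refl sum.swap)
    also have "\<dots> = (\<Sum>m\<in>M. \<Sum>i\<le>k. \<Sum>j\<le>k - i. (a (c i j) m * (x$1 ^ i * x$2 ^ j)) *\<^sub>R T m)"
      by (rule sum.swap)
    finally show ?thesis by (simp add: g_def scaleR_sum_left)
  qed
  moreover have "g m \<in> polyfun2 k" for m
    unfolding polyfun_iff g_def by (intro exI[of _ "\<lambda>i j. a (c i j) m"]) simp
  ultimately show thesis using c(2) by (intro that[of g]) simp_all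
qed

lemma poly_spaceI:
  assumes X: "subspace X" and T: "\<And>m. m \<in> M \<Longrightarrow> T m \<in> X" and g: "\<And>m. m \<in> M \<Longrightarrow> g m \<in> polyfun2 k"
    and f: "\<And>x. x \<in> D \<Longrightarrow> f x = (\<Sum>m\<in>M. g m x *\<^sub>R T m)"
  shows "restr D f \<in> poly_space k D X"
proof -
  have "\<forall>m\<in>M. \<exists>c. g m = (\<lambda>x. \<Sum>i\<le>k. \<Sum>j\<le>k - i. c i j * (x$1 ^ i * x$2 ^ j))"
    using g unfolding polyfun_iff by blast
  then obtain c where c: "\<And>m. m \<in> M \<Longrightarrow> g m = (\<lambda>x. \<Sum>i\<le>k. \<Sum>j\<le>k - i. c m i j * (x$1 ^ i * x$2 ^ j))"
    by (subst (asm) bchoice_iff) blast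
  define d where "d i j = (\<Sum>m\<in>M. c m i j *\<^sub>R T m)" for i j
  have "d i j \<in> X" for i j
    unfolding d_def using X T by (intro subspace_sum subspace_scale)
  moreover have "(\<Sum>m\<in>M. g m x *\<^sub>R T m) = (\<Sum>i\<le>k. \<Sum>j\<le>k - i. (x$1 ^ i * x$2 ^ j) *\<^sub>R d i j)" for x
  proof -
    have "(\<Sum>i\<le>k. \<Sum>j\<le>k - i. (x$1 ^ i * x$2 ^ j) *\<^sub>R d i j)
        = (\<Sum>i\<le>k. \<Sum>m\<in>M. \<Sum>j\<le>k - i. (c m i j * (x$1 ^ i * x$2 ^ j)) *\<^sub>R T m)"
      by (simp add: d_def scaleR_sum_right mult.commute) (intro sum.cong refl sum.swap)
    also have "\<dots> = (\<Sum>m\<in>M. \<Sum>i\<le>k. \<Sum>j\<le>k - i. (c m i j * (x$1 ^ i * x$2 ^ j)) *\<^sub>R T m)"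
      by (rule sum.swap)
    also have "\<dots> = (\<Sum>m\<in>M. g m x *\<^sub>R T m)"
      by (intro sum.cong refl) (simp add: c scaleR_sum_left)
    finally show ?thesis by simp
  qed
  ultimately show ?thesis
    using f unfolding poly_space_def restr_def by (intro CollectI exI[of _ d]) (auto simp: fun_eq_iff)
qed

lemma poly_space_UNIV_real: "poly_space k D UNIV = restr D ` polyfun2 k"
proof (intro equalityI subsetI)
  fix f :: "real^2 \<Rightarrow> real" assume f: "f \<in> poly_space k D UNIV"
  have "\<exists>a. A = (\<Sum>m\<in>{()}. a m *\<^sub>R 1)" for A :: real by (intro exI[of _ "\<lambda>_. A"]) simp
  from poly_spaceE[OF f this] obtain g
    where "\<And>m. g m \<in> polyfun2 k" "f = restr D (\<lambda>x. \<Sum>m\<in>{()}. g m x *\<^sub>R 1)" by blast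
  then show "f \<in> restr D ` polyfun2 k" by simp
next
  fix f assume "f \<in> restr D ` polyfun2 k"
  then obtain g where g: "g \<in> polyfun2 k" "f = restr D g" by auto
  show "f \<in> poly_space k D UNIV"
    unfolding g(2) by (rule poly_spaceI[where M = "{()}" and T = "\<lambda>_. 1" and g = "\<lambda>_. g"]) (use g in auto)
qed

lemma continuous_on_polyfun2:
  assumes "f \<in> polyfun2 k" shows "continuous_on A f"
  using assms by (induction rule: polyfun_induct) (auto intro!: continuous_intros)

lemma continuous_on_restr: "continuous_on D f \<Longrightarrow> continuous_on D (restr D f)"
  by (rule continuous_on_eq) (auto simp: restr_def)

section \<open>Barycentric coordinates and integrals over triangles\<close>

definition cross2 :: "real^2 \<Rightarrow> real^2 \<Rightarrow> real" where
  "cross2 a b = a$1 * b$2 - a$2 * b$1"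

text \<open>Ratio of the signed areas of the triangles x b c and a b c. The denominator is invariant
  under cyclic relabelling, so the three coordinates share it.\<close>

definition bary :: "real^2 \<Rightarrow> real^2 \<Rightarrow> real^2 \<Rightarrow> real^2 \<Rightarrow> real" where
  "bary a b c x = cross2 (b - x) (c - x) / cross2 (b - a) (c - a)"

lemma cross2_cycle: "cross2 (c - b) (a - b) = cross2 (b - a) (c - a)"
  and cross2_cycle': "cross2 (a - c) (b - c) = cross2 (b - a) (c - a)"
  by (simp_all add: cross2_def algebra_simps)

lemma bary_expand:
  "bary a b c x = cross2 (b - x) (c - x) / cross2 (b - a) (c - a)"
  "bary b c a x = cross2 (c - x) (a - x) / cross2 (b - a) (c - a)"
  "bary c a b x = cross2 (a - x) (b - x) / cross2 (b - a) (c - a)"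
  by (simp_all add: bary_def cross2_cycle cross2_cycle')

lemma bary_sum:
  assumes "cross2 (b - a) (c - a) \<noteq> 0"
  shows "bary a b c x + bary b c a x + bary c a b x = 1"
proof -
  have "cross2 (b - x) (c - x) + cross2 (c - x) (a - x) + cross2 (a - x) (b - x) = cross2 (b - a) (c - a)"
    by (simp add: cross2_def algebra_simps)
  with assms show ?thesis
    unfolding bary_expand[where a = a and b = b and c = c and x = x] by (simp add: add_divide_distrib[symmetric])
qed

lemma bary_comb:
  assumes D: "cross2 (b - a) (c - a) \<noteq> 0"
  shows "bary a b c x *\<^sub>R a + bary b c a x *\<^sub>R b + bary c a b x *\<^sub>R c = x"
proof -
  have "cross2 (b - x) (c - x) * a$i + cross2 (c - x) (a - x) * b$i + cross2 (a - x) (b - x) * c$i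
      = cross2 (b - a) (c - a) * x$i" for i
    using exhaust_2[of i] by (auto simp: cross2_def algebra_simps)
  from this[of 1] this[of 2] D show ?thesis
    unfolding bary_expand[where a = a and b = b and c = c and x = x] by (simp add: vec_eq_iff forall_2 divide_simps)
qed

lemma bary_eqI:
  assumes D: "cross2 (b - a) (c - a) \<noteq> 0" and x: "x = p *\<^sub>R a + q *\<^sub>R b + r *\<^sub>R c" "p + q + r = 1"
  shows "bary a b c x = p" "bary b c a x = q" "bary c a b x = r"
proof -
  have p: "p = 1 - q - r" using x by simp
  have "cross2 (b - x) (c - x) = p * cross2 (b - a) (c - a)"
    "cross2 (c - x) (a - x) = q * cross2 (b - a) (c - a)"
    "cross2 (a - x) (b - x) = r * cross2 (b - a) (c - a)"
    unfolding x(1) p by (simp_all add: cross2_def algebra_simps)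
  with D show "bary a b c x = p" "bary b c a x = q" "bary c a b x = r"
    unfolding bary_expand[where a = a and b = b and c = c and x = x] by simp_all
qed

lemma convex_hull_bary:
  assumes D: "cross2 (b - a) (c - a) \<noteq> 0"
  shows "convex hull {a, b, c} = {x. 0 \<le> bary a b c x \<and> 0 \<le> bary b c a x \<and> 0 \<le> bary c a b x}"
proof (intro equalityI subsetI)
  fix x assume "x \<in> convex hull {a, b, c}"
  then show "x \<in> {x. 0 \<le> bary a b c x \<and> 0 \<le> bary b c a x \<and> 0 \<le> bary c a b x}"
    unfolding convex_hull_3 using bary_eqI[OF D] by auto
next
  fix x assume "x \<in> {x. 0 \<le> bary a b c x \<and> 0 \<le> bary b c a x \<and> 0 \<le> bary c a b x}"
  then show "x \<in> convex hull {a, b, c}"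
    unfolding convex_hull_3 using bary_comb[OF D, of x] bary_sum[OF D, of x] by force
qed

lemma continuous_on_bary [continuous_intros]:
  "continuous_on A (bary a b c)"
  unfolding bary_def cross2_def divide_inverse by (intro continuous_intros)

lemma bary_has_derivative [derivative_intros]:
  "(bary a b c has_derivative (\<lambda>h. cross2 (c - b) h / cross2 (b - a) (c - a))) (at x within A)"
proof -
  have "bounded_linear (cross2 (c - b))"
    unfolding linear_conv_bounded_linear[symmetric]
    by (rule linearI) (simp_all add: cross2_def algebra_simps)
  note [derivative_intros] = bounded_linear.has_derivative[OF this]
  have "bary a b c = (\<lambda>x. (cross2 (c - b) x + cross2 b c) / cross2 (b - a) (c - a))"
  proof
    fix x
    have "cross2 (b - x) (c - x) = cross2 (c - b) x + cross2 b c"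
      by (simp add: cross2_def algebra_simps)
    then show "bary a b c x = (cross2 (c - b) x + cross2 b c) / cross2 (b - a) (c - a)"
      by (simp add: bary_def)
  qed
  then show ?thesis
    unfolding divide_inverse by (auto intro!: derivative_eq_intros)
qed

section \<open>Affine change of variables between triangles\<close>

lemma integrable_on_continuous_compact:
  fixes f :: "'a::euclidean_space \<Rightarrow> 'b::euclidean_space"
  assumes "compact S" "continuous_on S f"
  shows "f absolutely_integrable_on S" "f integrable_on S"
proof -
  note int = borel_integrable_compact[OF assms]
  show "f absolutely_integrable_on S"
    unfolding set_integrable_def using int integrable_completion[OF borel_measurable_integrable[OF int]] by simp
  then show "f integrable_on S" by (rule set_lebesgue_integral_eq_integral)
qed

lemma integral_affine_triangle:
  fixes a b c a' b' c' :: "real^2" and f :: "real^2 \<Rightarrow> real"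
  defines "g \<equiv> \<lambda>x. bary a b c x *\<^sub>R a' + bary b c a x *\<^sub>R b' + bary c a b x *\<^sub>R c'"
  assumes D: "cross2 (b - a) (c - a) \<noteq> 0" and E: "cross2 (b' - a') (c' - a') \<noteq> 0"
    and f: "continuous_on (convex hull {a', b', c'}) f"
  shows "integral (convex hull {a', b', c'}) f
    = \<bar>cross2 (b' - a') (c' - a') / cross2 (b - a) (c - a)\<bar> * integral (convex hull {a, b, c}) (\<lambda>x. f (g x))"
proof -
  let ?D = "cross2 (b - a) (c - a)" and ?E = "cross2 (b' - a') (c' - a')"
  let ?K = "convex hull {a, b, c}" and ?K' = "convex hull {a', b', c'}"
  define g' where "g' h = (cross2 (c - b) h / ?D) *\<^sub>R a' + (cross2 (a - c) h / ?D) *\<^sub>R b'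
    + (cross2 (b - a) h / ?D) *\<^sub>R c'" for h
  have der: "(g has_derivative g') (at x within A)" for x A
    unfolding g_def g'_def
    by (auto intro!: derivative_eq_intros simp: cross2_cycle cross2_cycle')
  \<comment> \<open>Multiplying by the determinants clears the denominators of \<open>bary\<close>
    and leaves a polynomial identity.\<close>
  have "?D * ?D * det (matrix g') = ?E * ?D"
    using D by (simp add: g'_def matrix_def det_2 axis_def cross2_def divide_simps) (simp add: algebra_simps)
  then have det: "det (matrix g') = ?E / ?D" using D by (simp add: field_simps)
  have img: "g ` ?K = ?K'"
  proof (intro equalityI subsetI)
    fix y assume "y \<in> g ` ?K"
    then obtain x where "x \<in> ?K" "y = g x" by auto
    then show "y \<in> ?K'" using bary_sum[OF D, of x]
      unfolding convex_hull_bary[OF D] convex_hull_3[of a' b' c'] g_def by blast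
  next
    fix y assume "y \<in> ?K'"
    then obtain u v w where uvw: "0 \<le> u" "0 \<le> v" "0 \<le> w" "u + v + w = 1" "y = u *\<^sub>R a' + v *\<^sub>R b' + w *\<^sub>R c'"
      unfolding convex_hull_3 by auto
    have "y = g (u *\<^sub>R a + v *\<^sub>R b + w *\<^sub>R c)"
      unfolding g_def using bary_eqI[OF D refl uvw(4)] uvw(5) by simp
    then show "y \<in> g ` ?K" using uvw unfolding convex_hull_3 by blast
  qed
  have inj: "inj_on g ?K"
  proof (rule inj_onI)
    fix x y assume "g x = g y"
    then show "x = y"
      using bary_eqI[OF E g_def[THEN meta_eq_to_obj_eq, THEN fun_cong, of x] bary_sum[OF D]]
        bary_eqI[OF E g_def[THEN meta_eq_to_obj_eq, THEN fun_cong, of y] bary_sum[OF D]]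
        bary_comb[OF D, of x] bary_comb[OF D, of y] by simp
  qed
  have cK: "compact ?K" "compact ?K'" by (simp_all add: compact_convex_hull)
  have cg: "continuous_on ?K g" unfolding g_def by (intro continuous_intros)
  have fg: "continuous_on ?K (\<lambda>x. f (g x))"
    using continuous_on_compose2[OF f cg] img by simp
  \<comment> \<open>Values in \<open>real^1\<close> bring f into the vector-valued form of the
    change-of-variables theorem.\<close>
  define F :: "real^2 \<Rightarrow> real^1" where "F x = vec (f x)" for x
  have F: "F absolutely_integrable_on ?K'"
    unfolding absolutely_integrable_on_1_iff by (simp add: F_def integrable_on_continuous_compact[OF cK(2) f])
  have "integral (g ` ?K) F = integral ?K (\<lambda>x. \<bar>det (matrix g')\<bar> *\<^sub>R F (g x))"
    by (rule integral_change_of_variables[OF _ der inj]) (use cK F img lmeasurable_compact in auto)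
  then have "integral ?K' F $ 1 = integral ?K (\<lambda>x. \<bar>det (matrix g')\<bar> *\<^sub>R F (g x)) $ 1"
    using img by simp
  then show ?thesis unfolding integral_on_1_eq
    by (simp add: F_def det)
qed


section \<open>Moments of barycentric monomials over a triangle\<close>

definition tri_integral :: "real^2 \<Rightarrow> real^2 \<Rightarrow> real^2 \<Rightarrow> (real \<Rightarrow> real \<Rightarrow> real \<Rightarrow> real) \<Rightarrow> real" where
  "tri_integral a b c F = integral (convex hull {a, b, c}) (\<lambda>x. F (bary a b c x) (bary b c a x) (bary c a b x))"

definition cont3 :: "(real \<Rightarrow> real \<Rightarrow> real \<Rightarrow> real) \<Rightarrow> bool" where
  "cont3 F \<longleftrightarrow> continuous_on UNIV (\<lambda>(x, y, z). F x y z)"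

lemma cont3_bary: "cont3 F \<Longrightarrow> continuous_on A (\<lambda>x. F (bary a b c x) (bary b c a x) (bary c a b x))"
  using continuous_on_compose2[of UNIV "\<lambda>(x, y, z). F x y z" A "\<lambda>x. (bary a b c x, bary b c a x, bary c a b x)"]
  unfolding cont3_def by (simp add: continuous_on_Pair continuous_on_bary)

lemma tri_integral_integrable:
  "cont3 F \<Longrightarrow> (\<lambda>x. F (bary a b c x) (bary b c a x) (bary c a b x)) integrable_on convex hull {a, b, c}"
  by (intro integrable_on_continuous_compact(2) cont3_bary) (simp_all add: compact_convex_hull)

lemma tri_integral_add:
  "cont3 F \<Longrightarrow> cont3 G \<Longrightarrow> tri_integral a b c (\<lambda>x y z. F x y z + G x y z) = tri_integral a b c F + tri_integral a b c G"
  unfolding tri_integral_def by (intro integral_add tri_integral_integrable)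

lemma tri_integral_cmul: "tri_integral a b c (\<lambda>x y z. k * F x y z) = k * tri_integral a b c F"
  unfolding tri_integral_def by (rule integral_mult_right)

lemma cross2_combination:
  assumes "p + q + r = 1" "p' + q' + r' = 1" "p'' + q'' + r'' = 1"
  shows "cross2 (p' *\<^sub>R a + q' *\<^sub>R b + r' *\<^sub>R c - (p *\<^sub>R a + q *\<^sub>R b + r *\<^sub>R c)) (p'' *\<^sub>R a + q'' *\<^sub>R b + r'' *\<^sub>R c - (p *\<^sub>R a + q *\<^sub>R b + r *\<^sub>R c))
    = ((q' - q) * (r'' - r) - (r' - r) * (q'' - q)) * cross2 (b - a) (c - a)"
proof -
  have p: "p = 1 - q - r" "p' = 1 - q' - r'" "p'' = 1 - q'' - r''" using assms by auto
  show ?thesis unfolding p by (simp add: cross2_def algebra_simps)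
qed

text \<open>The barycentric coordinates of each of a', b', c' sum to one, so their 3 by 3
  determinant reduces to the 2 by 2 expression in \<open>E\<close>, which is the signed ratio of the
  areas.\<close>

lemma tri_integral_affine:
  assumes D: "cross2 (b - a) (c - a) \<noteq> 0" and F: "cont3 F"
    and a': "a' = p *\<^sub>R a + q *\<^sub>R b + r *\<^sub>R c" "p + q + r = 1"
    and b': "b' = p' *\<^sub>R a + q' *\<^sub>R b + r' *\<^sub>R c" "p' + q' + r' = 1"
    and c': "c' = p'' *\<^sub>R a + q'' *\<^sub>R b + r'' *\<^sub>R c" "p'' + q'' + r'' = 1"
    and E: "(q' - q) * (r'' - r) - (r' - r) * (q'' - q) \<noteq> 0"
  shows "integral (convex hull {a', b', c'}) (\<lambda>x. F (bary a b c x) (bary b c a x) (bary c a b x))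
    = \<bar>(q' - q) * (r'' - r) - (r' - r) * (q'' - q)\<bar> *
      tri_integral a b c (\<lambda>x y z. F (p * x + p' * y + p'' * z) (q * x + q' * y + q'' * z) (r * x + r' * y + r'' * z))"
proof -
  have cross: "cross2 (b' - a') (c' - a') = ((q' - q) * (r'' - r) - (r' - r) * (q'' - q)) * cross2 (b - a) (c - a)"
    unfolding a'(1) b'(1) c'(1) by (rule cross2_combination) fact+
  have E': "cross2 (b' - a') (c' - a') \<noteq> 0" using cross D E by simp
  have g: "bary a b c (x *\<^sub>R a' + y *\<^sub>R b' + z *\<^sub>R c') = p * x + p' * y + p'' * z"
    "bary b c a (x *\<^sub>R a' + y *\<^sub>R b' + z *\<^sub>R c') = q * x + q' * y + q'' * z"
    "bary c a b (x *\<^sub>R a' + y *\<^sub>R b' + z *\<^sub>R c') = r * x + r' * y + r'' * z" if "x + y + z = 1" for x y z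
  proof -
    have 1: "x *\<^sub>R a' + y *\<^sub>R b' + z *\<^sub>R c' = (p * x + p' * y + p'' * z) *\<^sub>R a + (q * x + q' * y + q'' * z) *\<^sub>R b
        + (r * x + r' * y + r'' * z) *\<^sub>R c"
      unfolding a'(1) b'(1) c'(1) by (simp add: algebra_simps)
    have "(p * x + p' * y + p'' * z) + (q * x + q' * y + q'' * z) + (r * x + r' * y + r'' * z)
      = (p + q + r) * x + (p' + q' + r') * y + (p'' + q'' + r'') * z" by (simp add: algebra_simps)
    also have "\<dots> = 1" unfolding a' b' c' using that by simp
    finally show "bary a b c (x *\<^sub>R a' + y *\<^sub>R b' + z *\<^sub>R c') = p * x + p' * y + p'' * z"
      "bary b c a (x *\<^sub>R a' + y *\<^sub>R b' + z *\<^sub>R c') = q * x + q' * y + q'' * z"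
      "bary c a b (x *\<^sub>R a' + y *\<^sub>R b' + z *\<^sub>R c') = r * x + r' * y + r'' * z"
      using bary_eqI[OF D 1] by simp_all
  qed
  show ?thesis
    using D by (simp add: integral_affine_triangle[OF D E' cont3_bary[OF F]] tri_integral_def cross g bary_sum)
qed

lemma negligible_bary_eq:
  assumes D: "cross2 (b - a) (c - a) \<noteq> 0"
  shows "negligible {x. bary b c a x = bary c a b x}"
proof -
  \<comment> \<open>The vector (b - a) + (c - a) turned by a right angle, hence normal to the median
    through a, on which the two coordinates agree.\<close>
  define u :: "real^2" where "u = (\<chi> i. if i = 1 then 2 * a$2 - b$2 - c$2 else b$1 + c$1 - 2 * a$1)"
  have "{x. bary b c a x = bary c a b x} \<subseteq> {x. u \<bullet> x = u \<bullet> a}"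
    unfolding bary_expand[where a = a and b = b and c = c] using D
    by (auto simp: u_def cross2_def inner_vec_def sum_2 algebra_simps)
  moreover have "u \<noteq> 0"
  proof
    assume "u = 0"
    then have "u $ 1 = 0" "u $ 2 = 0" by simp_all
    then have "b $ 2 = 2 * a $ 2 - c $ 2" "b $ 1 = 2 * a $ 1 - c $ 1" by (simp_all add: u_def)
    with D show False by (simp add: cross2_def algebra_simps)
  qed
  ultimately show ?thesis using negligible_hyperplane[of u "u \<bullet> a"] negligible_subset by blast
qed

text \<open>Cutting the triangle along the median through \<open>a\<close> gives linear relations between the
  moments of barycentric monomials, which replace an explicit integration.\<close>

lemma tri_integral_bisect:
  assumes D: "cross2 (b - a) (c - a) \<noteq> 0" and F: "cont3 F"
  shows "tri_integral a b c F = 1/2 * tri_integral a b c (\<lambda>x y z. F x (y + z/2) (z/2))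
    + 1/2 * tri_integral a b c (\<lambda>x y z. F x (y/2) (y/2 + z))"
proof -
  define m where "m = (1/2) *\<^sub>R b + (1/2) *\<^sub>R c"
  let ?f = "\<lambda>x. F (bary a b c x) (bary b c a x) (bary c a b x)"
  have sub1: "convex hull {a, b, m} = {x \<in> convex hull {a, b, c}. bary c a b x \<le> bary b c a x}"
  proof (intro equalityI subsetI)
    fix x assume "x \<in> convex hull {a, b, m}"
    then obtain u v w where uvw: "0 \<le> u" "0 \<le> v" "0 \<le> w" "u + v + w = 1" "x = u *\<^sub>R a + v *\<^sub>R b + w *\<^sub>R m"
      unfolding convex_hull_3 by blast
    have "x = u *\<^sub>R a + (v + w/2) *\<^sub>R b + (w/2) *\<^sub>R c" "u + (v + w/2) + w/2 = 1"
      using uvw by (simp_all add: m_def algebra_simps)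
    from bary_eqI[OF D this] uvw show "x \<in> {x \<in> convex hull {a, b, c}. bary c a b x \<le> bary b c a x}"
      by (simp add: convex_hull_bary[OF D])
  next
    fix x assume x: "x \<in> {x \<in> convex hull {a, b, c}. bary c a b x \<le> bary b c a x}"
    have "x = bary a b c x *\<^sub>R a + (bary b c a x - bary c a b x) *\<^sub>R b + (2 * bary c a b x) *\<^sub>R m"
      using bary_comb[OF D, of x] by (simp add: m_def algebra_simps)
    with x bary_sum[OF D, of x] show "x \<in> convex hull {a, b, m}"
      unfolding convex_hull_3[of a b m]
      by (intro CollectI exI[of _ "bary a b c x"] exI[of _ "bary b c a x - bary c a b x"] exI[of _ "2 * bary c a b x"])
        (auto simp: convex_hull_bary[OF D])
  qed
  have sub2: "convex hull {a, m, c} = {x \<in> convex hull {a, b, c}. bary b c a x \<le> bary c a b x}"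
  proof (intro equalityI subsetI)
    fix x assume "x \<in> convex hull {a, m, c}"
    then obtain u v w where uvw: "0 \<le> u" "0 \<le> v" "0 \<le> w" "u + v + w = 1" "x = u *\<^sub>R a + v *\<^sub>R m + w *\<^sub>R c"
      unfolding convex_hull_3 by blast
    have "x = u *\<^sub>R a + (v/2) *\<^sub>R b + (v/2 + w) *\<^sub>R c" "u + v/2 + (v/2 + w) = 1"
      using uvw by (simp_all add: m_def algebra_simps)
    from bary_eqI[OF D this] uvw show "x \<in> {x \<in> convex hull {a, b, c}. bary b c a x \<le> bary c a b x}"
      by (simp add: convex_hull_bary[OF D])
  next
    fix x assume x: "x \<in> {x \<in> convex hull {a, b, c}. bary b c a x \<le> bary c a b x}"
    have "x = bary a b c x *\<^sub>R a + (2 * bary b c a x) *\<^sub>R m + (bary c a b x - bary b c a x) *\<^sub>R c"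
      using bary_comb[OF D, of x] by (simp add: m_def algebra_simps)
    with x bary_sum[OF D, of x] show "x \<in> convex hull {a, m, c}"
      unfolding convex_hull_3[of a m c]
      by (intro CollectI exI[of _ "bary a b c x"] exI[of _ "2 * bary b c a x"] exI[of _ "bary c a b x - bary b c a x"])
        (auto simp: convex_hull_bary[OF D])
  qed
  have "convex hull {a, b, c} = convex hull {a, b, m} \<union> convex hull {a, m, c}"
    unfolding sub1 sub2 by auto
  moreover have "negligible (convex hull {a, b, m} \<inter> convex hull {a, m, c})"
    unfolding sub1 sub2 by (rule negligible_subset[OF negligible_bary_eq[OF D]]) auto
  moreover have "?f integrable_on convex hull {a, b, m}" "?f integrable_on convex hull {a, m, c}"
    by (intro integrable_on_continuous_compact(2) cont3_bary F; simp add: compact_convex_hull)+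
  ultimately have "tri_integral a b c F = integral (convex hull {a, b, m}) ?f + integral (convex hull {a, m, c}) ?f"
    unfolding tri_integral_def by simp
  also have "integral (convex hull {a, b, m}) ?f = 1/2 * tri_integral a b c (\<lambda>x y z. F x (y + z/2) (z/2))"
    by (subst tri_integral_affine[OF D F, of a 1 0 0 b 0 1 0 m 0 "1/2" "1/2"]) (simp_all add: m_def)
  also have "integral (convex hull {a, m, c}) ?f = 1/2 * tri_integral a b c (\<lambda>x y z. F x (y/2) (y/2 + z))"
    by (subst tri_integral_affine[OF D F, of a 1 0 0 m 0 "1/2" "1/2" c 0 0 1]) (simp_all add: m_def)
  finally show ?thesis .
qed

lemma tri_integral_rotate:
  assumes D: "cross2 (b - a) (c - a) \<noteq> 0" and F: "cont3 F"
  shows "tri_integral a b c (\<lambda>x y z. F z x y) = tri_integral a b c F"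
proof -
  have "convex hull {b, c, a} = convex hull {a, b, c}" by (simp add: insert_commute)
  then show ?thesis
    using tri_integral_affine[OF D F, of b 0 1 0 c 0 0 1 a 1 0 0] by (simp add: tri_integral_def)
qed

lemma tri_integral_swap:
  assumes D: "cross2 (b - a) (c - a) \<noteq> 0" and F: "cont3 F"
  shows "tri_integral a b c (\<lambda>x y z. F x z y) = tri_integral a b c F"
proof -
  have "convex hull {a, c, b} = convex hull {a, b, c}" by (simp add: insert_commute)
  then show ?thesis
    using tri_integral_affine[OF D F, of a 1 0 0 c 0 0 1 b 0 1 0] by (simp add: tri_integral_def)
qed

lemma cont3_intros [intro!]:
  "cont3 (\<lambda>x y z. k)" "cont3 (\<lambda>x y z. x)" "cont3 (\<lambda>x y z. y)" "cont3 (\<lambda>x y z. z)"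
  "cont3 F \<Longrightarrow> cont3 G \<Longrightarrow> cont3 (\<lambda>x y z. F x y z + G x y z)"
  "cont3 F \<Longrightarrow> cont3 G \<Longrightarrow> cont3 (\<lambda>x y z. F x y z * G x y z)"
  "cont3 F \<Longrightarrow> cont3 (\<lambda>x y z. F x y z ^ i)"
  unfolding cont3_def by (auto simp: case_prod_beta intro!: continuous_intros)

lemma tri_integral_one_pos:
  assumes D: "cross2 (b - a) (c - a) \<noteq> 0"
  shows "0 < tri_integral a b c (\<lambda>x y z. 1)"
proof -
  have borel: "convex hull {a, b, c} \<in> sets lborel"
    by (simp add: compact_convex_hull borel_compact)
  have "tri_integral a b c (\<lambda>x y z. 1) = measure lebesgue (convex hull {a, b, c})"
    unfolding tri_integral_def by (subst lmeasure_integral) (auto intro!: lmeasurable_compact simp: compact_convex_hull)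
  also have "\<dots> = \<bar>cross2 (b - a) (c - a)\<bar> / 2"
    using content_triangle[of a b c]
    unfolding cross2_def measure_completion[OF borel] by (simp add: algebra_simps abs_minus_commute)
  finally show ?thesis using D by simp
qed

text \<open>Relabelling the vertices reduces all cubic monomials to three moments A, B, C, those of
  x y z, y^2 z and y^3. The cut along the median yields B = 2A and C = 3B, and integrating (x + y +
  z)^3 = 1 shows that the area is 60 A, so A is positive.\<close>

lemma tri_integral_cubic_monomials:
  assumes D: "cross2 (b - a) (c - a) \<noteq> 0"
  obtains A where "0 < A" "tri_integral a b c (\<lambda>x y z. x * y * z) = A"
    "tri_integral a b c (\<lambda>x y z. y\<^sup>2 * z) = 2 * A" "tri_integral a b c (\<lambda>x y z. y * z\<^sup>2) = 2 * A"
    "tri_integral a b c (\<lambda>x y z. z\<^sup>2 * x) = 2 * A" "tri_integral a b c (\<lambda>x y z. z * x\<^sup>2) = 2 * A"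
    "tri_integral a b c (\<lambda>x y z. x\<^sup>2 * y) = 2 * A" "tri_integral a b c (\<lambda>x y z. x * y\<^sup>2) = 2 * A"
proof -
  let ?I = "tri_integral a b c"
  define A where "A = ?I (\<lambda>x y z. x * y * z)"
  define B where "B = ?I (\<lambda>x y z. y\<^sup>2 * z)"
  define C where "C = ?I (\<lambda>x y z. y ^ 3)"
  note rot = tri_integral_rotate[OF D] and swap = tri_integral_swap[OF D]
  have B1: "?I (\<lambda>x y z. y\<^sup>2 * z) = B" by (simp add: B_def)
  have B2: "?I (\<lambda>x y z. x\<^sup>2 * y) = B" by (rule trans[OF rot B1]) auto
  have B3: "?I (\<lambda>x y z. z\<^sup>2 * x) = B" by (rule trans[OF rot B2]) auto
  have "?I (\<lambda>x y z. z\<^sup>2 * y) = B" by (rule trans[OF swap B1]) auto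
  then have B4: "?I (\<lambda>x y z. y * z\<^sup>2) = B" by (simp add: mult.commute)
  have B5: "?I (\<lambda>x y z. x * y\<^sup>2) = B" by (rule trans[OF rot B4]) auto
  have B6: "?I (\<lambda>x y z. z * x\<^sup>2) = B" by (rule trans[OF rot B5]) auto
  have C1: "?I (\<lambda>x y z. y ^ 3) = C" by (simp add: C_def)
  have C2: "?I (\<lambda>x y z. x ^ 3) = C" by (rule trans[OF rot C1]) auto
  have C3: "?I (\<lambda>x y z. z ^ 3) = C" by (rule trans[OF rot C2]) auto
  note vals = A_def[symmetric] B1 B2 B3 B4 B5 B6 C1 C2 C3
  have "A = 1/2 * ?I (\<lambda>x y z. x * (y + z/2) * (z/2)) + 1/2 * ?I (\<lambda>x y z. x * (y/2) * (y/2 + z))"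
    unfolding A_def by (rule tri_integral_bisect[OF D]) auto
  also have "(\<lambda>x y z::real. x * (y + z/2) * (z/2)) = (\<lambda>x y z. 1/2 * (x * y * z) + 1/4 * (z\<^sup>2 * x))"
    by (simp add: fun_eq_iff power2_eq_square algebra_simps)
  also have "(\<lambda>x y z::real. x * (y/2) * (y/2 + z)) = (\<lambda>x y z. 1/2 * (x * y * z) + 1/4 * (x * y\<^sup>2))"
    by (simp add: fun_eq_iff power2_eq_square algebra_simps)
  also have "?I (\<lambda>x y z. 1/2 * (x * y * z) + 1/4 * (z\<^sup>2 * x)) = 1/2 * A + 1/4 * B"
    by (subst tri_integral_add, (intro cont3_intros)+) (simp only: tri_integral_cmul vals)
  also have "?I (\<lambda>x y z. 1/2 * (x * y * z) + 1/4 * (x * y\<^sup>2)) = 1/2 * A + 1/4 * B"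
    by (subst tri_integral_add, (intro cont3_intros)+) (simp only: tri_integral_cmul vals)
  finally have BA: "B = 2 * A" by simp
  have "C = 1/2 * ?I (\<lambda>x y z. (y + z/2) ^ 3) + 1/2 * ?I (\<lambda>x y z. (y/2) ^ 3)"
    unfolding C_def by (rule tri_integral_bisect[OF D]) auto
  also have "(\<lambda>x y z::real. (y + z/2) ^ 3) = (\<lambda>x y z. y^3 + 3/2 * (y\<^sup>2 * z) + 3/4 * (y * z\<^sup>2) + 1/8 * z^3)"
    by (simp add: fun_eq_iff power2_eq_square power3_eq_cube field_simps)
  also have "(\<lambda>(x::real) (y::real) (z::real). (y/2) ^ 3) = (\<lambda>x y z. 1/8 * y^3)"
    by (simp add: fun_eq_iff power3_eq_cube)
  also have "?I (\<lambda>x y z. y^3 + 3/2 * (y\<^sup>2 * z) + 3/4 * (y * z\<^sup>2) + 1/8 * z^3) = C + 3/2 * B + 3/4 * B + 1/8 * C"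
    by (subst tri_integral_add, (intro cont3_intros)+)+ (simp only: tri_integral_cmul vals)
  also have "?I (\<lambda>x y z. 1/8 * y^3) = 1/8 * C" by (simp only: tri_integral_cmul vals)
  finally have "16 * C = 10 * C + 18 * B" by (simp add: field_simps)
  then have CB: "C = 3 * B" by simp
  have "?I (\<lambda>x y z. 1) = ?I (\<lambda>x y z. x^3 + y^3 + z^3 + 3 * (y\<^sup>2 * z) + 3 * (y * z\<^sup>2) + 3 * (z\<^sup>2 * x) + 3 * (z * x\<^sup>2)
      + 3 * (x\<^sup>2 * y) + 3 * (x * y\<^sup>2) + 6 * (x * y * z))"
    unfolding tri_integral_def
  proof (rule Henstock_Kurzweil_Integration.integral_cong)
    fix p
    have "x^3 + y^3 + z^3 + 3 * (y\<^sup>2 * z) + 3 * (y * z\<^sup>2) + 3 * (z\<^sup>2 * x) + 3 * (z * x\<^sup>2)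
      + 3 * (x\<^sup>2 * y) + 3 * (x * y\<^sup>2) + 6 * (x * y * z) = (x + y + z) ^ 3" for x y z :: real
      by (simp add: power2_eq_square power3_eq_cube algebra_simps)
    then show "1 = bary a b c p ^ 3 + bary b c a p ^ 3 + bary c a b p ^ 3 + 3 * ((bary b c a p)\<^sup>2 * bary c a b p)
      + 3 * (bary b c a p * (bary c a b p)\<^sup>2) + 3 * ((bary c a b p)\<^sup>2 * bary a b c p) + 3 * (bary c a b p * (bary a b c p)\<^sup>2)
      + 3 * ((bary a b c p)\<^sup>2 * bary b c a p) + 3 * (bary a b c p * (bary b c a p)\<^sup>2)
      + 6 * (bary a b c p * bary b c a p * bary c a b p)"
      by (simp add: bary_sum[OF D])
  qed
  also have "\<dots> = C + C + C + 3 * B + 3 * B + 3 * B + 3 * B + 3 * B + 3 * B + 6 * A"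
    by (subst tri_integral_add, (intro cont3_intros)+)+ (simp only: tri_integral_cmul vals)
  finally have "0 < A" using tri_integral_one_pos[OF D] BA CB by simp
  from that[OF this A_def[symmetric]] show thesis using B1 B2 B3 B4 B5 B6 BA by simp
qed

section \<open>Homogeneous cubics in barycentric coordinates\<close>

text \<open>The coefficients are grouped as those of the cubes, of the cyclic family y^2 z, z^2 x,
  x^2 y, of its mirror image, and of x y z. Each triple is ordered so that a cyclic change of
  variables is a cyclic shift within it, namely \<open>rot_cubic\<close>.\<close>

type_synonym cubic = "real \<times> real \<times> real \<times> real \<times> real \<times> real \<times> real \<times> real \<times> real \<times> real"

fun cub :: "cubic \<Rightarrow> real \<Rightarrow> real \<Rightarrow> real \<Rightarrow> real" where
  "cub (a0, a1, a2, b0, b1, b2, c0, c1, c2, d) x y z =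
     a0 * x^3 + a1 * y^3 + a2 * z^3 + b0 * (y\<^sup>2 * z) + b1 * (z\<^sup>2 * x) + b2 * (x\<^sup>2 * y)
     + c0 * (y * z\<^sup>2) + c1 * (z * x\<^sup>2) + c2 * (x * y\<^sup>2) + d * (x * y * z)"

text \<open>The derivative of \<open>cub C\<close> at $(x, y, z)$ in direction $(u, v, w)$.\<close>

fun dcub :: "cubic \<Rightarrow> real \<Rightarrow> real \<Rightarrow> real \<Rightarrow> real \<Rightarrow> real \<Rightarrow> real \<Rightarrow> real" where
  "dcub (a0, a1, a2, b0, b1, b2, c0, c1, c2, d) u v w x y z =
     (3 * a0 * x\<^sup>2 + b1 * z\<^sup>2 + 2 * b2 * x * y + 2 * c1 * z * x + c2 * y\<^sup>2 + d * y * z) * u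
     + (3 * a1 * y\<^sup>2 + b2 * x\<^sup>2 + 2 * b0 * y * z + 2 * c2 * x * y + c0 * z\<^sup>2 + d * x * z) * v
     + (3 * a2 * z\<^sup>2 + b0 * y\<^sup>2 + 2 * b1 * z * x + 2 * c0 * y * z + c1 * x\<^sup>2 + d * x * y) * w"

fun rot_cubic :: "cubic \<Rightarrow> cubic" where
  "rot_cubic (a0, a1, a2, b0, b1, b2, c0, c1, c2, d) = (a1, a2, a0, b1, b2, b0, c1, c2, c0, d)"

lemma cubic_cases:
  fixes C :: cubic
  obtains a0 a1 a2 b0 b1 b2 c0 c1 c2 d where "C = (a0, a1, a2, b0, b1, b2, c0, c1, c2, d)"
  by (metis prod.exhaust)

lemma cub_rot_cubic: "cub (rot_cubic C) x y z = cub C z x y"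
  by (cases C rule: cubic_cases) (simp add: algebra_simps)

lemma linear_cub: "linear (\<lambda>C. cub C x y z)"
proof (rule linearI)
  show "cub (C + C') x y z = cub C x y z + cub C' x y z" for C C'
    by (cases C rule: cubic_cases; cases C' rule: cubic_cases) (simp add: algebra_simps)
  show "cub (r *\<^sub>R C) x y z = r *\<^sub>R cub C x y z" for r C
    by (cases C rule: cubic_cases) (simp add: algebra_simps)
qed

lemma linear_dcub: "linear (\<lambda>C. dcub C u v w x y z)"
proof (rule linearI)
  show "dcub (C + C') u v w x y z = dcub C u v w x y z + dcub C' u v w x y z" for C C'
    by (cases C rule: cubic_cases; cases C' rule: cubic_cases) (simp add: algebra_simps)
  show "dcub (r *\<^sub>R C) u v w x y z = r *\<^sub>R dcub C u v w x y z" for r C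
    by (cases C rule: cubic_cases) (simp add: algebra_simps)
qed

lemmas cub_simps = linear_add[OF linear_cub] linear_scale[OF linear_cub]

lemma cont3_cub: "cont3 (cub C)"
proof -
  obtain a0 a1 a2 b0 b1 b2 c0 c1 c2 d where C: "C = (a0, a1, a2, b0, b1, b2, c0, c1, c2, d)"
    by (cases C rule: cubic_cases)
  have "cont3 (\<lambda>x y z. cub C x y z)"
    unfolding C cub.simps by (intro cont3_intros)
  then show ?thesis by simp
qed

lemma cub_has_derivative [derivative_intros]:
  assumes "(f has_derivative f') (at p within A)" "(g has_derivative g') (at p within A)"
    "(h has_derivative h') (at p within A)"
  shows "((\<lambda>p. cub C (f p) (g p) (h p)) has_derivative
    (\<lambda>q. dcub C (f' q) (g' q) (h' q) (f p) (g p) (h p))) (at p within A)"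
proof -
  obtain a0 a1 a2 b0 b1 b2 c0 c1 c2 d where C: "C = (a0, a1, a2, b0, b1, b2, c0, c1, c2, d)"
    by (cases C rule: cubic_cases)
  show ?thesis
    unfolding C cub.simps
    by (rule has_derivative_eq_rhs, (rule derivative_intros assms)+)
      (simp add: fun_eq_iff power2_eq_square algebra_simps)
qed

text \<open>Serves to homogenise: where x + y + z = 1, a monomial of lower degree becomes a product
  of three linear forms by padding with factors x + y + z.\<close>

lemma cub_product:
  "\<exists>C. \<forall>x y z. cub C x y z = (\<alpha>1 * x + \<beta>1 * y + \<gamma>1 * z) * (\<alpha>2 * x + \<beta>2 * y + \<gamma>2 * z) * (\<alpha>3 * x + \<beta>3 * y + \<gamma>3 * z)"
  by (rule exI[of _ "(\<alpha>1 * \<alpha>2 * \<alpha>3, \<beta>1 * \<beta>2 * \<beta>3, \<gamma>1 * \<gamma>2 * \<gamma>3,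
      \<beta>1 * \<beta>2 * \<gamma>3 + \<beta>1 * \<gamma>2 * \<beta>3 + \<gamma>1 * \<beta>2 * \<beta>3,
      \<gamma>1 * \<gamma>2 * \<alpha>3 + \<gamma>1 * \<alpha>2 * \<gamma>3 + \<alpha>1 * \<gamma>2 * \<gamma>3,
      \<alpha>1 * \<alpha>2 * \<beta>3 + \<alpha>1 * \<beta>2 * \<alpha>3 + \<beta>1 * \<alpha>2 * \<alpha>3,
      \<gamma>1 * \<gamma>2 * \<beta>3 + \<gamma>1 * \<beta>2 * \<gamma>3 + \<beta>1 * \<gamma>2 * \<gamma>3,
      \<alpha>1 * \<alpha>2 * \<gamma>3 + \<alpha>1 * \<gamma>2 * \<alpha>3 + \<gamma>1 * \<alpha>2 * \<alpha>3,
      \<beta>1 * \<beta>2 * \<alpha>3 + \<beta>1 * \<alpha>2 * \<beta>3 + \<alpha>1 * \<beta>2 * \<beta>3,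
      \<alpha>1 * \<beta>2 * \<gamma>3 + \<alpha>1 * \<gamma>2 * \<beta>3 + \<beta>1 * \<alpha>2 * \<gamma>3 + \<beta>1 * \<gamma>2 * \<alpha>3 + \<gamma>1 * \<alpha>2 * \<beta>3 + \<gamma>1 * \<beta>2 * \<alpha>3)"])
    (simp add: power2_eq_square power3_eq_cube algebra_simps)

lemma polyfun_imp_cub:
  assumes "f \<in> polyfun u v 3"
  shows "\<exists>C. \<forall>x. f x = cub C (u x) (v x) (1 - u x - v x)"
  using assms
proof (induction rule: polyfun_induct)
  case 0
  show ?case by (rule exI[of _ 0]) (simp add: linear_0[OF linear_cub])
next
  case (add f g)
  then obtain C C' where "\<forall>x. f x = cub C (u x) (v x) (1 - u x - v x)" "\<forall>x. g x = cub C' (u x) (v x) (1 - u x - v x)" by blast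
  then show ?case by (intro exI[of _ "C + C'"]) (simp add: cub_simps del: cub.simps)
next
  case (scale c f)
  then obtain C where "\<forall>x. f x = cub C (u x) (v x) (1 - u x - v x)" by blast
  then show ?case by (intro exI[of _ "c *\<^sub>R C"]) (simp add: cub_simps del: cub.simps)
next
  case (monomial i j)
  then have "i = 0 \<or> i = 1 \<or> i = 2 \<or> i = 3" "j = 0 \<or> j = 1 \<or> j = 2 \<or> j = 3"
    by linarith+
  with monomial have ij: "(i, j) \<in> {(0,0),(1,0),(0,1),(2,0),(1,1),(0,2),(3,0),(2,1),(1,2),(0,3)}"
    by (elim disjE) simp_all
  have *: "\<exists>C. \<forall>x. (\<alpha>1 * u x + \<beta>1 * v x + \<gamma>1 * (1 - u x - v x)) * (\<alpha>2 * u x + \<beta>2 * v x + \<gamma>2 * (1 - u x - v x))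
      * (\<alpha>3 * u x + \<beta>3 * v x + \<gamma>3 * (1 - u x - v x)) = cub C (u x) (v x) (1 - u x - v x)"
    for \<alpha>1 \<beta>1 \<gamma>1 \<alpha>2 \<beta>2 \<gamma>2 \<alpha>3 \<beta>3 \<gamma>3
    using cub_product[of \<alpha>1 \<beta>1 \<gamma>1 \<alpha>2 \<beta>2 \<gamma>2 \<alpha>3 \<beta>3 \<gamma>3] by metis
  \<comment> \<open>One instance per monomial of degree at most 3; a triple 1 1 1 is the padding
    factor u + v + (1 - u - v) = 1.\<close>
  from ij show ?case
    using *[of 1 1 1 1 1 1 1 1 1]
      *[of 1 0 0 1 1 1 1 1 1]
      *[of 0 1 0 1 1 1 1 1 1]
      *[of 1 0 0 1 0 0 1 1 1]
      *[of 1 0 0 0 1 0 1 1 1]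
      *[of 0 1 0 0 1 0 1 1 1]
      *[of 1 0 0 1 0 0 1 0 0]
      *[of 1 0 0 1 0 0 0 1 0]
      *[of 1 0 0 0 1 0 0 1 0]
      *[of 0 1 0 0 1 0 0 1 0]
    by (elim insertE) (simp_all add: power2_eq_square power3_eq_cube mult.assoc del: split_paired_Ex cub.simps)
qed

lemma polyfun_cub:
  assumes "f \<in> polyfun u v 1" "g \<in> polyfun u v 1" "h \<in> polyfun u v 1"
  shows "(\<lambda>x. cub C (f x) (g x) (h x)) \<in> polyfun u v 3"
proof -
  obtain a0 a1 a2 b0 b1 b2 c0 c1 c2 d where C: "C = (a0, a1, a2, b0, b1, b2, c0, c1, c2, d)"
    by (cases C rule: cubic_cases)
  have *: "(\<lambda>x. k * (f x * g x * h x)) \<in> polyfun u v 3"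
    if "f \<in> polyfun u v 1" "g \<in> polyfun u v 1" "h \<in> polyfun u v 1" for k f g h
    using polyfun_mult[OF polyfun_mult[OF that(1,2)] that(3)] by (intro polyfun_scale) (simp add: numeral_3_eq_3)
  have "y * z\<^sup>2 = y * z * z" "z\<^sup>2 * y = z * z * y" for y z :: real by (simp_all add: power2_eq_square)
  then show ?thesis
    unfolding C cub.simps power3_eq_cube by (simp only:) (intro polyfun_add * assms)
qed

section \<open>Cubic symmetric matrix fields on a triangle\<close>

lemma restr_cong: "(\<And>x. x \<in> D \<Longrightarrow> f x = g x) \<Longrightarrow> restr D f = restr D g"
  by (auto simp: restr_def)

locale triangle =
  fixes a b c :: "real^2"
  assumes nondeg: "cross2 (b - a) (c - a) \<noteq> 0"
begin

abbreviation K :: "(real^2) set" where "K \<equiv> convex hull {a, b, c}"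

lemma rotate: "triangle b c a"
  using nondeg by unfold_locales (simp add: cross2_cycle)

lemma compact_K: "compact K"
  by (simp add: compact_convex_hull)

lemma bary_vertices [simp]:
  "bary a b c a = 1" "bary b c a a = 0" "bary c a b a = 0"
  "bary a b c b = 0" "bary b c a b = 1" "bary c a b b = 0"
  "bary a b c c = 0" "bary b c a c = 0" "bary c a b c = 1"
  using bary_eqI[OF nondeg, of a 1 0 0] bary_eqI[OF nondeg, of b 0 1 0] bary_eqI[OF nondeg, of c 0 0 1]
  by auto

lemma vertices_in_K [simp]: "a \<in> K" "b \<in> K" "c \<in> K"
  by (simp_all add: hull_inc)

lemma polyfun2_bary: "bary a b c \<in> polyfun2 1"
proof -
  have "bary a b c x = cross2 b c / cross2 (b - a) (c - a)
    + ((c - b)$1 / cross2 (b - a) (c - a)) * x$2 + (- (c - b)$2 / cross2 (b - a) (c - a)) * x$1" for x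
  proof -
    have "cross2 (b - x) (c - x) = cross2 b c + (c - b)$1 * x$2 + (- (c - b)$2) * x$1"
      by (simp add: cross2_def algebra_simps)
    then show ?thesis by (simp add: bary_def add_divide_distrib)
  qed
  then have "bary a b c = (\<lambda>x. cross2 b c / cross2 (b - a) (c - a)
    + ((c - b)$1 / cross2 (b - a) (c - a)) * x$2 + (- (c - b)$2 / cross2 (b - a) (c - a)) * x$1)" by blast
  moreover have "(\<lambda>x. k + l * x$2 + m * x$1) \<in> polyfun2 1" for k l m
    unfolding One_nat_def by (intro polyfun_add polyfun_const polyfun_scale polyfun_fst polyfun_snd)
  ultimately show ?thesis by (simp only:)
qed

lemma polyfun2_imp_bary: "f \<in> polyfun2 k \<Longrightarrow> f \<in> polyfun (bary a b c) (bary b c a) k"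
proof (rule polyfun_trans)
  have "x$i = c$i + (a - c)$i * bary a b c x + (b - c)$i * bary b c a x" for x i
  proof -
    have "x$i = (bary a b c x *\<^sub>R a + bary b c a x *\<^sub>R b + bary c a b x *\<^sub>R c)$i"
      using bary_comb[OF nondeg, of x] by simp
    moreover have "bary c a b x = 1 - bary a b c x - bary b c a x" using bary_sum[OF nondeg, of x] by simp
    ultimately show ?thesis by (simp add: algebra_simps)
  qed
  then have *: "(\<lambda>x. x$i) = (\<lambda>x. c$i + (a - c)$i * bary a b c x + (b - c)$i * bary b c a x)" for i by blast
  have "(\<lambda>x. k + l * bary a b c x + m * bary b c a x) \<in> polyfun (bary a b c) (bary b c a) 1" for k l m
    unfolding One_nat_def by (intro polyfun_add polyfun_const polyfun_scale polyfun_fst polyfun_snd)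
  then have "(\<lambda>x. x$i) \<in> polyfun (bary a b c) (bary b c a) 1" for i by (subst *)
  then show "(\<lambda>x. x$1) \<in> polyfun (bary a b c) (bary b c a) 1" "(\<lambda>x. x$2) \<in> polyfun (bary a b c) (bary b c a) 1" by blast+
qed

end

definition outer :: "real^2 \<Rightarrow> real^2^2" where
  "outer u = (\<chi> i j. u$i * u$j)"

lemma outer_nth [simp]: "outer u $ i $ j = u$i * u$j"
  by (simp add: outer_def)

lemma outer_in_sym_mats: "outer u \<in> sym_mats"
  by (simp add: sym_mats_def transpose_def vec_eq_iff)

lemma subspace_sym_mats: "subspace sym_mats"
  by (auto simp: subspace_def sym_mats_def transpose_def vec_eq_iff)

text \<open>With J the rotation by a right angle, B x y is the inner product of J x with A (J y),
  and that of J x with y is \<open>cross2 x y\<close>. Hence B v (u + v) vanishes on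
  \<open>outer v\<close> and on \<open>outer (u + v)\<close>, and similarly for the other two forms,
  so they read off the coefficients up to the square of \<open>cross2 u v\<close> and a
  sign.\<close>

lemma sym_mats_outer:
  assumes A: "A \<in> sym_mats" and D: "cross2 u v \<noteq> 0"
  shows "\<exists>p q r. A = p *\<^sub>R outer u + q *\<^sub>R outer v + r *\<^sub>R outer (u + v)"
proof -
  define B where "B x y = A$1$1 * (x$2 * y$2) - A$1$2 * (x$1 * y$2 + x$2 * y$1) + A$2$2 * (x$1 * y$1)" for x y :: "real^2"
  have A21: "A$2$1 = A$1$2" using A unfolding sym_mats_def transpose_def vec_eq_iff by auto
  have "(cross2 u v)\<^sup>2 * A$i$j = B v (u + v) * (u$i * u$j) + B (u + v) u * (v$i * v$j)
      - B u v * ((u + v)$i * (u + v)$j)" for i j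
    using exhaust_2[of i] exhaust_2[of j]
    by (auto simp: B_def cross2_def A21 power2_eq_square algebra_simps)
  from this[of 1 1] this[of 1 2] this[of 2 1] this[of 2 2] D
  have "A = (B v (u + v) / (cross2 u v)\<^sup>2) *\<^sub>R outer u + (B (u + v) u / (cross2 u v)\<^sup>2) *\<^sub>R outer v
      + (- B u v / (cross2 u v)\<^sup>2) *\<^sub>R outer (u + v)"
    by (simp add: vec_eq_iff forall_2 divide_simps) (simp add: algebra_simps)
  then show ?thesis by blast
qed

definition cubic_field :: "real^2 \<Rightarrow> real^2 \<Rightarrow> real^2 \<Rightarrow> cubic \<Rightarrow> cubic \<Rightarrow> cubic \<Rightarrow> real^2 \<Rightarrow> real^2^2" where
  "cubic_field a b c p q r x =
     cub p (bary a b c x) (bary b c a x) (bary c a b x) *\<^sub>R outer (c - b)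
   + cub q (bary a b c x) (bary b c a x) (bary c a b x) *\<^sub>R outer (a - c)
   + cub r (bary a b c x) (bary b c a x) (bary c a b x) *\<^sub>R outer (b - a)"

lemma cubic_field_rotate:
  "cubic_field b c a (rot_cubic q) (rot_cubic r) (rot_cubic p) = cubic_field a b c p q r"
  by (simp add: fun_eq_iff cubic_field_def cub_rot_cubic)

context triangle
begin

lemma cross2_edges: "cross2 (c - b) (a - c) = cross2 (b - a) (c - a)"
  "cross2 (a - c) (b - a) = cross2 (b - a) (c - a)" "cross2 (b - a) (c - b) = cross2 (b - a) (c - a)"
  by (simp_all add: cross2_def algebra_simps)

lemma poly_space_3_sym_mats: "poly_space 3 K sym_mats = {restr K (cubic_field a b c p q r) | p q r. True}"
proof (intro equalityI subsetI)
  define T where "T m = (if m = 0 then outer (c - b) else if m = 1 then outer (a - c) else outer (b - a))" for m :: nat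
  have T: "(\<Sum>m<3. g m *\<^sub>R T m) = g 0 *\<^sub>R outer (c - b) + g 1 *\<^sub>R outer (a - c) + g 2 *\<^sub>R outer (b - a)" for g
    by (simp add: T_def numeral_3_eq_3 numeral_2_eq_2)
  {
    fix f assume f: "f \<in> poly_space 3 K sym_mats"
    have "\<exists>g. A = (\<Sum>m<3. g m *\<^sub>R T m)" if A: "A \<in> sym_mats" for A
    proof -
      obtain p q r where "A = p *\<^sub>R outer (c - b) + q *\<^sub>R outer (a - c) + r *\<^sub>R outer ((c - b) + (a - c))"
        using sym_mats_outer[OF A, of "c - b" "a - c"] nondeg cross2_edges by auto
      moreover have "outer ((c - b) + (a - c)) = outer (b - a)"
        by (simp add: outer_def vec_eq_iff algebra_simps)
      ultimately show ?thesis
        unfolding T by (intro exI[of _ "\<lambda>m. if m = 0 then p else if m = 1 then q else r"]) simp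
    qed
    from poly_spaceE[OF f this] obtain g where g: "\<And>m. g m \<in> polyfun2 3"
      "f = restr K (\<lambda>x. \<Sum>m<3. g m x *\<^sub>R T m)" by blast
    have "\<exists>C. \<forall>x. g m x = cub C (bary a b c x) (bary b c a x) (bary c a b x)" for m
    proof -
      have "bary c a b x = 1 - bary a b c x - bary b c a x" for x using bary_sum[OF nondeg, of x] by simp
      then show ?thesis using polyfun_imp_cub[OF polyfun2_imp_bary[OF g(1)]] by presburger
    qed
    then obtain C where C: "\<And>m x. g m x = cub (C m) (bary a b c x) (bary b c a x) (bary c a b x)" by metis
    have "f = restr K (cubic_field a b c (C 0) (C 1) (C 2))"
      unfolding g(2) T by (simp add: cubic_field_def[abs_def] C)
    then show "f \<in> {restr K (cubic_field a b c p q r) | p q r. True}" by blast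
  }
  fix f assume "f \<in> {restr K (cubic_field a b c p q r) | p q r. True}"
  then obtain p q r where f: "f = restr K (cubic_field a b c p q r)" by blast
  define g where "g m x = cub (if m = 0 then p else if m = 1 then q else r) (bary a b c x) (bary b c a x) (bary c a b x)" for m :: nat and x
  have "bary b c a \<in> polyfun2 1" "bary c a b \<in> polyfun2 1"
    using triangle.polyfun2_bary[OF rotate] triangle.polyfun2_bary[OF triangle.rotate[OF rotate]] by auto
  then have g: "g m \<in> polyfun2 3" for m
    unfolding g_def by (intro polyfun_cub polyfun2_bary)
  show "f \<in> poly_space 3 K sym_mats"
    unfolding f
  proof (rule poly_spaceI[OF subspace_sym_mats, where M = "{..<3}" and g = g and T = T])
    show "T m \<in> sym_mats" for m by (simp add: T_def outer_in_sym_mats)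
    show "cubic_field a b c p q r x = (\<Sum>m<3. g m x *\<^sub>R T m)" for x
      unfolding T by (simp add: g_def cubic_field_def)
  qed (rule g)
qed

end

section \<open>Divergence of cubic fields\<close>

lemma has_derivative_unique_convex:
  fixes f :: "'a::real_normed_vector \<Rightarrow> 'b::real_normed_vector"
  assumes S: "convex S" "x \<in> S" "y \<in> S"
    and f': "(f has_derivative f') (at x within S)" and f'': "(f has_derivative f'') (at x within S)"
  shows "f' (y - x) = f'' (y - x)"
proof -
  \<comment> \<open>S need not be a neighbourhood of x, so uniqueness is reduced to the one-sided
    derivative along the segment from x to y.\<close>
  define g where "g s = x + s *\<^sub>R (y - x)" for s :: real
  have gS: "g ` {0..1} \<subseteq> S"
  proof clarify
    fix s :: real assume "s \<in> {0..1}"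
    then show "g s \<in> S"
      using convexD_alt[OF S, of s] by (simp add: g_def algebra_simps)
  qed
  have g: "(g has_derivative (\<lambda>h. h *\<^sub>R (y - x))) (at 0 within {0..1})"
    unfolding g_def by (auto intro!: derivative_eq_intros)
  have *: "((\<lambda>s. f (g s)) has_derivative (\<lambda>h. F (h *\<^sub>R (y - x)))) (at 0 within {0..1})"
    if "(f has_derivative F) (at x within S)" for F
    by (rule has_derivative_in_compose[OF g, of f F])
      (use has_derivative_subset[OF that gS] in \<open>simp add: g_def\<close>)
  have "((\<lambda>s. f (g s)) has_vector_derivative F (y - x)) (at 0 within {0..1})"
    if F: "(f has_derivative F) (at x within S)" for F
    unfolding has_vector_derivative_def
    using *[OF F] linear_scale[OF has_derivative_linear[OF F]] by simp
  from vector_derivative_unique_within_closed_interval[of 0 1 0, unfolded cbox_interval, OF _ _ this[OF f'] this[OF f'']]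
  show ?thesis by simp
qed

lemma dcub_add: "dcub C (u + u') (v + v') (w + w') x y z = dcub C u v w x y z + dcub C u' v' w' x y z"
  and dcub_scale: "dcub C (k * u) (k * v) (k * w) x y z = k * dcub C u v w x y z"
  by (cases C rule: cubic_cases; simp add: algebra_simps)+

context triangle
begin

text \<open>\<open>frechet_derivative\<close> selects some derivative within \<open>K\<close>, and
  \<open>K\<close> is no neighbourhood of its boundary points. All candidates agree on differences
  of points of \<open>K\<close>, and among these b - a and c - a span the plane.\<close>

lemma frechet_derivative_restr_K:
  fixes F :: "real^2 \<Rightarrow> 'b::real_normed_vector"
  assumes F: "(F has_derivative F') (at x)" and x: "x \<in> K"
  shows "frechet_derivative (restr K F) (at x within K) = F'"
proof -
  have F': "(restr K F has_derivative F') (at x within K)"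
    by (rule has_derivative_transform[OF x _ has_derivative_at_withinI[OF F]]) (simp add: restr_def)
  let ?G = "frechet_derivative (restr K F) (at x within K)"
  have G: "(restr K F has_derivative ?G) (at x within K)"
    using F' unfolding frechet_derivative_works[symmetric] differentiable_def by blast
  note lin = has_derivative_linear[OF F'] has_derivative_linear[OF G]
  have "?G (y - x) = F' (y - x)" if "y \<in> K" for y
    by (rule has_derivative_unique_convex[OF _ x that G F']) simp
  then have edge: "?G (y - z) = F' (y - z)" if "y \<in> K" "z \<in> K" for y z
    using linear_diff[OF lin(1), of "y - x" "z - x"] linear_diff[OF lin(2), of "y - x" "z - x"] that by simp
  show ?thesis
  proof
    fix h
    have "h = bary b c a (a + h) *\<^sub>R (b - a) + bary c a b (a + h) *\<^sub>R (c - a)"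
    proof -
      have "bary a b c (a + h) = 1 - bary b c a (a + h) - bary c a b (a + h)"
        using bary_sum[OF nondeg, of "a + h"] by simp
      with bary_comb[OF nondeg, of "a + h"] show ?thesis by (simp add: algebra_simps)
    qed
    then obtain s u where h: "h = s *\<^sub>R (b - a) + u *\<^sub>R (c - a)" by blast
    show "?G h = F' h"
      unfolding h using edge[of b a] edge[of c a]
      by (simp add: linear_add[OF lin(1)] linear_add[OF lin(2)] linear_scale[OF lin(1)] linear_scale[OF lin(2)])
  qed
qed

text \<open>The divergence of f times \<open>outer u\<close> is the derivative of f along u, times
  u. Along c - b the barycentric coordinates change by (0, -1, 1), and cyclically; these are the
  direction arguments of \<open>dcub\<close>.\<close>

lemma row_div_cubic_field:
  "row_div K (restr K (cubic_field a b c p q r)) = restr K (\<lambda>x.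
     dcub p 0 (-1) 1 (bary a b c x) (bary b c a x) (bary c a b x) *\<^sub>R (c - b)
   + dcub q 1 0 (-1) (bary a b c x) (bary b c a x) (bary c a b x) *\<^sub>R (a - c)
   + dcub r (-1) 1 0 (bary a b c x) (bary b c a x) (bary c a b x) *\<^sub>R (b - a))"
  unfolding row_div_def
proof (rule restr_cong)
  fix x assume x: "x \<in> K"
  let ?l = "\<lambda>C. \<lambda>u v w. dcub C u v w (bary a b c x) (bary b c a x) (bary c a b x)"
  let ?D = "cross2 (b - a) (c - a)"
  let ?d = "\<lambda>C h. ?l C (cross2 (c - b) h / ?D) (cross2 (a - c) h / ?D) (cross2 (b - a) h / ?D)"
  define F' where "F' h = ?d p h *\<^sub>R outer (c - b) + ?d q h *\<^sub>R outer (a - c) + ?d r h *\<^sub>R outer (b - a)" for h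
  have "(cubic_field a b c p q r has_derivative F') (at x)"
    unfolding cubic_field_def[abs_def] F'_def
    by (auto intro!: derivative_eq_intros simp: cross2_cycle cross2_cycle')
  note fd = frechet_derivative_restr_K[OF this x]
  \<comment> \<open>\<open>dcub\<close> is linear in the direction, so the two partial derivatives
    reassemble to the derivative in direction t.\<close>
  have d: "?d C (axis 1 1) * t$1 + ?d C (axis 2 1) * t$2 = ?d C t" for C t
  proof -
    have "cross2 u t = t$1 * cross2 u (axis 1 1) + t$2 * cross2 u (axis 2 1)" for u
      by (simp add: cross2_def axis_def)
    then have "?d C t = ?l C (t$1 * (cross2 (c - b) (axis 1 1) / ?D) + t$2 * (cross2 (c - b) (axis 2 1) / ?D))
      (t$1 * (cross2 (a - c) (axis 1 1) / ?D) + t$2 * (cross2 (a - c) (axis 2 1) / ?D))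
      (t$1 * (cross2 (b - a) (axis 1 1) / ?D) + t$2 * (cross2 (b - a) (axis 2 1) / ?D))"
      by (simp add: add_divide_distrib)
    also have "\<dots> = t$1 * ?d C (axis 1 1) + t$2 * ?d C (axis 2 1)"
      unfolding dcub_add dcub_scale ..
    finally show ?thesis by (simp add: mult.commute)
  qed
  have dirs: "?d C (c - b) = ?l C 0 (-1) 1" "?d C (a - c) = ?l C 1 0 (-1)" "?d C (b - a) = ?l C (-1) 1 0" for C
  proof -
    have "cross2 u u = 0" "cross2 u v = - cross2 v u" for u v by (simp_all add: cross2_def)
    then have "cross2 (c - b) (c - b) = 0" "cross2 (a - c) (a - c) = 0" "cross2 (b - a) (b - a) = 0"
      "cross2 (a - c) (c - b) = - ?D" "cross2 (b - a) (a - c) = - ?D" "cross2 (c - b) (b - a) = - ?D"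
      using cross2_edges by metis+
    then show "?d C (c - b) = ?l C 0 (-1) 1" "?d C (a - c) = ?l C 1 0 (-1)" "?d C (b - a) = ?l C (-1) 1 0"
      using nondeg cross2_edges by simp_all
  qed
  show "(\<chi> i. \<Sum>j\<in>UNIV. frechet_derivative (restr K (cubic_field a b c p q r)) (at x within K) (axis j 1) $ i $ j)
    = ?l p 0 (-1) 1 *\<^sub>R (c - b) + ?l q 1 0 (-1) *\<^sub>R (a - c) + ?l r (-1) 1 0 *\<^sub>R (b - a)"
    unfolding fd
  proof (rule iffD2[OF vec_eq_iff], intro allI)
    fix i
    have "(\<chi> i. \<Sum>j\<in>UNIV. F' (axis j 1) $ i $ j) $ i
      = (?d p (axis 1 1) * (c - b)$1 + ?d p (axis 2 1) * (c - b)$2) * (c - b)$i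
      + (?d q (axis 1 1) * (a - c)$1 + ?d q (axis 2 1) * (a - c)$2) * (a - c)$i
      + (?d r (axis 1 1) * (b - a)$1 + ?d r (axis 2 1) * (b - a)$2) * (b - a)$i"
      by (simp add: F'_def sum_2 del: vector_minus_component) (simp add: algebra_simps del: vector_minus_component)
    also have "\<dots> = (?l p 0 (-1) 1 *\<^sub>R (c - b) + ?l q 1 0 (-1) *\<^sub>R (a - c) + ?l r (-1) 1 0 *\<^sub>R (b - a)) $ i"
      unfolding d dirs by simp
    finally show "(\<chi> i. \<Sum>j\<in>UNIV. F' (axis j 1) $ i $ j) $ i
      = (?l p 0 (-1) 1 *\<^sub>R (c - b) + ?l q 1 0 (-1) *\<^sub>R (a - c) + ?l r (-1) 1 0 *\<^sub>R (b - a)) $ i" .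
  qed
qed

end

text \<open>Membership in the space only concerns values on D; the midpoint test extracts from it an
  equation between three such values.\<close>

lemma poly_space_1_midpoint:
  assumes f: "f \<in> poly_space 1 D X" and D: "x \<in> D" "y \<in> D" "(1/2) *\<^sub>R (x + y) \<in> D"
  shows "f x + f y = 2 *\<^sub>R f ((1/2) *\<^sub>R (x + y))"
proof -
  obtain c where f: "f = restr D (\<lambda>x. \<Sum>i\<le>1. \<Sum>j\<le>1 - i. (x$1 ^ i * x$2 ^ j) *\<^sub>R c i j)"
    using f unfolding poly_space_def by blast
  have f: "f = restr D (\<lambda>x. c 0 0 + x$2 *\<^sub>R c 0 1 + x$1 *\<^sub>R c 1 0)"
    unfolding f by (simp add: restr_def)
  show ?thesis
    using D unfolding f restr_def
    by (simp add: scaleR_add_right) (simp add: scaleR_add_left scaleR_2)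
qed

text \<open>Third finite differences annihilate quadratics. With step 1/3 all four points lie on the
  segment, so a cubic term is detected from values on the edge alone.\<close>

lemma poly_space_2_third_difference:
  assumes f: "f \<in> poly_space 2 D UNIV" and D: "\<And>s. s \<in> {0..1} \<Longrightarrow> a + s *\<^sub>R u \<in> D"
  shows "f a - 3 * f (a + (1/3) *\<^sub>R u) + 3 * f (a + (2/3) *\<^sub>R u) - f (a + u) = (0::real)"
proof -
  obtain g where g: "g \<in> polyfun2 2" "f = restr D g"
    using f unfolding poly_space_UNIV_real by blast
  have "g a - 3 * g (a + (1/3) *\<^sub>R u) + 3 * g (a + (2/3) *\<^sub>R u) - g (a + u) = 0"
    using g(1)
  proof (induction rule: polyfun_induct)
    case (add f g)
    then show ?case by argo
  next
    case (scale c f)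
    have "c * (f a - 3 * f (a + (1/3) *\<^sub>R u) + 3 * f (a + (2/3) *\<^sub>R u) - f (a + u)) = 0"
      using scale by simp
    then show ?case by (simp add: algebra_simps)
  next
    case (monomial i j)
    then have "i = 0 \<or> i = 1 \<or> i = 2" "j = 0 \<or> j = 1 \<or> j = 2" by linarith+
    with monomial show ?case
      by (elim disjE) (simp_all add: power2_eq_square algebra_simps)
  qed simp
  then show ?thesis using D[of 0] D[of 1] D[of "1/3"] D[of "2/3"] by (simp add: g(2) restr_def)
qed

text \<open>For a fixed direction \<open>dcub\<close> is a quadratic form Q in (x, y, z), and this
  is the parallelogram law: the defect in the midpoint test is half of Q at the difference. For two
  vertices this difference is an edge direction.\<close>

lemma dcub_parallelogram:
  "dcub C u v w x y z + dcub C u v w x' y' z' - 2 * dcub C u v w ((x + x') / 2) ((y + y') / 2) ((z + z') / 2)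
    = 1/2 * dcub C u v w (x - x') (y - y') (z - z')"
proof -
  have *: "2 * dcub C u v w x y z + 2 * dcub C u v w (2 * X - x) (2 * Y - y) (2 * Z - z) - 4 * dcub C u v w X Y Z
    = dcub C u v w (x - (2 * X - x)) (y - (2 * Y - y)) (z - (2 * Z - z))" for X Y Z
    by (cases C rule: cubic_cases) (simp add: power2_eq_square algebra_simps)
  have mid: "2 * ((s + t) / 2) - s = t" for s t :: real by (simp add: field_simps)
  show ?thesis using *[of "(x + x') / 2" "(y + y') / 2" "(z + z') / 2"] unfolding mid by simp
qed

text \<open>The polarisation 2 B(e_i, e_j) = Q(e_i) + Q(e_j) - Q(e_i - e_j) trades the mixed terms
  for values in edge directions. If those vanish, Q agrees with a linear form on the plane x + y + z
  = 1.\<close>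

lemma dcub_quadratic_form:
  "dcub C u v w x y z = (dcub C u v w 1 0 0 * x + dcub C u v w 0 1 0 * y + dcub C u v w 0 0 1 * z) * (x + y + z)
    - dcub C u v w 1 (-1) 0 * x * y - dcub C u v w 0 1 (-1) * y * z - dcub C u v w 1 0 (-1) * x * z"
  by (cases C rule: cubic_cases) (simp add: power2_eq_square algebra_simps)

text \<open>The coefficients of the divergence with respect to $c - b$ and $a - c$, using
  $b - a = -(c - b) - (a - c)$; the quadratic forms are affine on
  $x + y + z = 1$ iff they vanish in the three edge directions.\<close>

definition div_coeffs :: "cubic \<times> cubic \<times> cubic \<Rightarrow> real \<Rightarrow> real \<Rightarrow> real \<Rightarrow> real \<times> real" where
  "div_coeffs C x y z = (case C of (p, q, r) \<Rightarrow>
    (dcub p 0 (-1) 1 x y z - dcub r (-1) 1 0 x y z, dcub q 1 0 (-1) x y z - dcub r (-1) 1 0 x y z))"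

lemma div_coeffs_parallelogram:
  "div_coeffs C x y z + div_coeffs C x' y' z' - 2 *\<^sub>R div_coeffs C ((x + x') / 2) ((y + y') / 2) ((z + z') / 2)
    = (1/2) *\<^sub>R div_coeffs C (x - x') (y - y') (z - z')"
proof -
  obtain p q r where C: "C = (p, q, r)" by (cases C)
  note P = dcub_parallelogram[of _ _ _ _ x y z x' y' z']
  show ?thesis
    using P[of p 0 "-1" 1] P[of q 1 0 "-1"] P[of r "-1" 1 0]
    by (simp add: div_coeffs_def C algebra_simps)
qed

lemma div_coeffs_quadratic_form:
  "div_coeffs C x y z = (x + y + z) *\<^sub>R (x *\<^sub>R div_coeffs C 1 0 0 + y *\<^sub>R div_coeffs C 0 1 0 + z *\<^sub>R div_coeffs C 0 0 1)
    - (x * y) *\<^sub>R div_coeffs C 1 (-1) 0 - (y * z) *\<^sub>R div_coeffs C 0 1 (-1) - (x * z) *\<^sub>R div_coeffs C 1 0 (-1)"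
proof -
  obtain p q r where C: "C = (p, q, r)" by (cases C)
  show ?thesis
    using dcub_quadratic_form[of p 0 "-1" 1 x y z] dcub_quadratic_form[of q 1 0 "-1" x y z]
      dcub_quadratic_form[of r "-1" 1 0 x y z]
    by (simp add: div_coeffs_def C algebra_simps)
qed

lemma cross2_independent:
  assumes "cross2 u v \<noteq> 0" "k *\<^sub>R u + l *\<^sub>R v = 0"
  shows "k = 0" "l = 0"
proof -
  have "l * cross2 u v = cross2 u (k *\<^sub>R u + l *\<^sub>R v)" "k * cross2 u v = cross2 (k *\<^sub>R u + l *\<^sub>R v) v"
    by (simp_all add: cross2_def algebra_simps)
  then have "l * cross2 u v = 0" "k * cross2 u v = 0" unfolding assms(2) by (simp_all add: cross2_def)
  with assms(1) show "k = 0" "l = 0" by simp_all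
qed

context triangle
begin

lemma row_div_cubic_field':
  "row_div K (restr K (cubic_field a b c p q r)) = restr K (\<lambda>x.
     fst (div_coeffs (p, q, r) (bary a b c x) (bary b c a x) (bary c a b x)) *\<^sub>R (c - b)
   + snd (div_coeffs (p, q, r) (bary a b c x) (bary b c a x) (bary c a b x)) *\<^sub>R (a - c))"
  unfolding row_div_cubic_field by (rule restr_cong) (simp add: div_coeffs_def algebra_simps)

lemma bary_midpoint:
  "bary a b c ((1/2) *\<^sub>R (x + y)) = (bary a b c x + bary a b c y) / 2"
proof (cases "cross2 (b - a) (c - a) = 0")
  case False
  have "cross2 (b - (1/2) *\<^sub>R (x + y)) (c - (1/2) *\<^sub>R (x + y)) = (cross2 (b - x) (c - x) + cross2 (b - y) (c - y)) / 2"
    by (simp add: cross2_def field_simps)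
  then show ?thesis by (simp add: bary_def add_divide_distrib)
qed (simp add: bary_def)

text \<open>Forward, the midpoint test at the three pairs of vertices leaves exactly the values in
  the edge directions. Backward, the mixed terms of \<open>div_coeffs_quadratic_form\<close> drop
  out, and the rest is affine because the barycentric coordinates sum to 1.\<close>

lemma row_div_in_poly_space_1_iff:
  "row_div K (restr K (cubic_field a b c p q r)) \<in> poly_space 1 K UNIV \<longleftrightarrow>
    div_coeffs (p, q, r) 1 (-1) 0 = 0 \<and> div_coeffs (p, q, r) 0 1 (-1) = 0 \<and> div_coeffs (p, q, r) 1 0 (-1) = 0"
  (is "?L \<longleftrightarrow> ?R")
proof
  let ?w = "\<lambda>x. div_coeffs (p, q, r) (bary a b c x) (bary b c a x) (bary c a b x)"
  let ?G = "\<lambda>x. fst (?w x) *\<^sub>R (c - b) + snd (?w x) *\<^sub>R (a - c)"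
  have rd: "row_div K (restr K (cubic_field a b c p q r)) = restr K ?G"
    by (rule row_div_cubic_field')
  {
    assume lhs: ?L
    have *: "div_coeffs (p, q, r) (bary a b c x - bary a b c y) (bary b c a x - bary b c a y) (bary c a b x - bary c a b y) = 0"
      if xy: "x \<in> K" "y \<in> K" for x y
    proof -
      let ?m = "(1/2) *\<^sub>R (x + y)"
      have m: "?m \<in> K" using convexD[OF convex_convex_hull xy, of "1/2" "1/2"] by (simp add: scaleR_add_right)
      have "?G x + ?G y = 2 *\<^sub>R ?G ?m"
        using poly_space_1_midpoint[OF lhs[unfolded rd] xy m] xy m by (simp add: restr_def)
      then have "fst (?w x + ?w y - 2 *\<^sub>R ?w ?m) *\<^sub>R (c - b) + snd (?w x + ?w y - 2 *\<^sub>R ?w ?m) *\<^sub>R (a - c) = 0"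
        by (simp add: algebra_simps)
      from cross2_independent[OF _ this] nondeg have 0: "?w x + ?w y - 2 *\<^sub>R ?w ?m = 0"
        by (simp add: cross2_edges prod_eq_iff)
      interpret rot: triangle b c a by (rule rotate)
      interpret rot': triangle c a b by (rule rot.rotate)
      show ?thesis
        using 0 unfolding bary_midpoint rot.bary_midpoint rot'.bary_midpoint div_coeffs_parallelogram by simp
    qed
    from *[of a b] *[of b c] *[of a c] show ?R by simp
  }
  assume R: ?R
  define L where "L x = bary a b c x *\<^sub>R div_coeffs (p, q, r) 1 0 0 + bary b c a x *\<^sub>R div_coeffs (p, q, r) 0 1 0
    + bary c a b x *\<^sub>R div_coeffs (p, q, r) 0 0 1" for x
  have w: "?w x = L x" for x
    using R bary_sum[OF nondeg, of x]
      div_coeffs_quadratic_form[of "(p, q, r)" "bary a b c x" "bary b c a x" "bary c a b x"]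
    by (simp add: L_def)
  have "bary b c a \<in> polyfun2 1" "bary c a b \<in> polyfun2 1"
    using triangle.polyfun2_bary[OF rotate] triangle.polyfun2_bary[OF triangle.rotate[OF rotate]] by auto
  then have poly: "(\<lambda>x. fst (L x)) \<in> polyfun2 1" "(\<lambda>x. snd (L x)) \<in> polyfun2 1"
    unfolding L_def by (auto intro!: polyfun_add polyfun2_bary polyfun_scale simp: mult.commute[of "bary _ _ _ _"] simp del: One_nat_def)
  show ?L
    unfolding rd w
    by (rule poly_spaceI[where M = "{..<2::nat}" and T = "\<lambda>m. if m = 0 then c - b else a - c"
        and g = "\<lambda>m. if m = 0 then (\<lambda>x. fst (L x)) else (\<lambda>x. snd (L x))"])
      (auto simp: poly[unfolded One_nat_def] numeral_2_eq_2)
qed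

section \<open>Vertices and edges of the triangle\<close>

lemma affine_independent: "\<not> affine_dependent {a, b, c}"
proof
  assume "affine_dependent {a, b, c}"
  then have "collinear {a, b, c}" using collinear_3_eq_affine_dependent by blast
  then obtain u where "\<forall>x\<in>{a, b, c}. \<forall>y\<in>{a, b, c}. \<exists>k. x - y = k *\<^sub>R u"
    unfolding collinear_def by blast
  then obtain k l where "b - a = k *\<^sub>R u" "c - a = l *\<^sub>R u" by blast
  then have "cross2 (b - a) (c - a) = 0" by (simp add: cross2_def)
  with nondeg show False by simp
qed

lemma distinct_vertices: "a \<noteq> b" "b \<noteq> c" "c \<noteq> a"
  using nondeg by (auto simp: cross2_def)

text \<open>Faces of the hull of an affinely independent set are the hulls of its subsets, and
  dimension one forces two points.\<close>

lemma edge_of_K_iff: "e edge_of K \<longleftrightarrow> e \<in> {closed_segment a b, closed_segment b c, closed_segment c a}"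
proof
  assume e: "e edge_of K"
  then obtain S where S: "S \<subseteq> {a, b, c}" "e = convex hull S"
    unfolding edge_of_def face_of_convex_hull_affine_independent[OF affine_independent] by blast
  have "\<not> affine_dependent S" using affine_independent S(1) affine_dependent_subset by blast
  then have "int (card S) = 2"
    using e S(2) aff_dim_affine_independent[of S] by (simp add: edge_of_def aff_dim_convex_hull)
  then have "card S = 2" by simp
  then obtain x y where "S = {x, y}" "x \<noteq> y" by (auto simp: card_2_iff)
  with S have "S = {a, b} \<or> S = {b, c} \<or> S = {c, a}" by blast
  then show "e \<in> {closed_segment a b, closed_segment b c, closed_segment c a}"
    unfolding S(2) segment_convex_hull by blast
next
  assume "e \<in> {closed_segment a b, closed_segment b c, closed_segment c a}"
  then obtain x y where xy: "e = convex hull {x, y}" "{x, y} \<subseteq> {a, b, c}" "x \<noteq> y"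
    unfolding segment_convex_hull using distinct_vertices by blast
  have "e face_of K"
    unfolding face_of_convex_hull_affine_independent[OF affine_independent] using xy by blast
  moreover have "aff_dim e = 1" using xy by (simp add: aff_dim_convex_hull aff_dim_2)
  ultimately show "e edge_of K" by (simp add: edge_of_def)
qed

lemma extreme_point_of_K_iff: "v extreme_point_of K \<longleftrightarrow> v \<in> {a, b, c}"
  by (rule extreme_point_of_convex_hull_affine_independent[OF affine_independent])

end

section \<open>Edge traces\<close>

lemma integral_reflect_01:
  fixes g :: "real \<Rightarrow> real"
  shows "integral {0..1} (\<lambda>s. g (1 - s)) = integral {0..1} g"
proof -
  have *: "((\<lambda>s. g (1 - s)) has_integral I) {0..1}" if "(g has_integral I) {0..1}" for g :: "real \<Rightarrow> real" and I
    using has_integral_affinity[of g I 0 1 "-1" 1] that by (simp add: image_affinity_atLeastAtMost)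
  have "((\<lambda>s. g (1 - s)) has_integral I) {0..1} \<longleftrightarrow> (g has_integral I) {0..1}" for I
    using *[of g I] *[of "\<lambda>s. g (1 - s)" I] by auto
  then show ?thesis by (simp add: integral_def integrable_on_def)
qed

text \<open>The endpoints picked by \<open>SOME\<close> are determined up to order, and reversing
  the order amounts to the reflection s -> 1 - s.\<close>

lemma edge_integral_closed_segment:
  "edge_integral (closed_segment a b) f = dist a b * integral {0..1} (\<lambda>s. f (a + s *\<^sub>R (b - a)))"
proof -
  define P where "P = (SOME (a', b'). closed_segment a b = closed_segment a' b')"
  have "case P of (a', b') \<Rightarrow> closed_segment a b = closed_segment a' b'"
    unfolding P_def by (rule someI[of _ "(a, b)"]) simp
  then obtain a' b' where P: "P = (a', b')" "closed_segment a b = closed_segment a' b'" by (cases P) auto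
  from P(2) have "{a, b} = {a', b'}" by (simp add: closed_segment_eq)
  then consider "a' = a" "b' = b" | "a' = b" "b' = a" by (auto simp: doubleton_eq_iff)
  then show ?thesis
  proof cases
    case 1
    then show ?thesis unfolding edge_integral_def P_def[symmetric] P(1) by simp
  next
    case 2
    have "(\<lambda>s. f (b + s *\<^sub>R (a - b))) = (\<lambda>s. f (a + (1 - s) *\<^sub>R (b - a)))"
      by (simp add: algebra_simps)
    then show ?thesis
      using 2 integral_reflect_01[of "\<lambda>s. f (a + s *\<^sub>R (b - a))"]
      unfolding edge_integral_def P_def[symmetric] P(1) by (simp add: dist_commute)
  qed
qed

text \<open>Degree 4 because cubic traces are tested with linear functions; there is no constant
  term because the traces in question vanish at the starting vertex.\<close>

lemma integral_quartic_01:
  "integral {0..1} (\<lambda>s::real. k1 * s + k2 * s\<^sup>2 + k3 * s^3 + k4 * s^4) = k1 / 2 + k2 / 3 + k3 / 4 + k4 / 5"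
proof -
  have "((\<lambda>s. k1 * s + k2 * s\<^sup>2 + k3 * s^3 + k4 * s^4) has_integral
      (k1 / 2 * 1\<^sup>2 + k2 / 3 * 1^3 + k3 / 4 * 1^4 + k4 / 5 * 1^5) - (k1 / 2 * 0\<^sup>2 + k2 / 3 * 0^3 + k3 / 4 * 0^4 + k4 / 5 * 0^5)) {0..1}"
    by (rule fundamental_theorem_of_calculus)
      (auto intro!: derivative_eq_intros simp: has_real_derivative_iff_has_vector_derivative[symmetric] divide_simps)
  then show ?thesis by (simp add: integral_unique)
qed

lemma in_closed_segmentE:
  assumes "x \<in> closed_segment a b"
  obtains s where "s \<in> {0..1}" "x = a + s *\<^sub>R (b - a)"
  using assms unfolding closed_segment_def by (auto simp: algebra_simps)

lemma in_closed_segmentI: "s \<in> {0..1} \<Longrightarrow> a + s *\<^sub>R (b - a) \<in> closed_segment a b"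
  unfolding closed_segment_def by (auto intro!: exI[of _ s] simp: algebra_simps)

lemma unit_tangent_closed_segment:
  assumes "unit_tangent (closed_segment a b) t"
  obtains \<rho> where "\<rho> \<noteq> 0" "t = \<rho> *\<^sub>R (b - a)"
proof -
  have "{x - y | x y. x \<in> closed_segment a b \<and> y \<in> closed_segment a b} \<subseteq> span {b - a}"
  proof clarify
    fix x y assume "x \<in> closed_segment a b" "y \<in> closed_segment a b"
    then obtain s u where *: "x = a + s *\<^sub>R (b - a)" "y = a + u *\<^sub>R (b - a)" by (metis in_closed_segmentE)
    have "x - y = (s - u) *\<^sub>R (b - a)" unfolding * by (simp add: algebra_simps)
    then show "x - y \<in> span {b - a}" by (simp add: span_scale span_base)
  qed
  then have "t \<in> span {b - a}"
    using assms span_minimal[OF _ subspace_span] unfolding unit_tangent_def by blast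
  then obtain \<rho> where "t = \<rho> *\<^sub>R (b - a)" by (auto simp: span_singleton)
  moreover have "t \<noteq> 0" using assms by (auto simp: unit_tangent_def)
  ultimately show thesis using that by auto
qed

lemma unit_normal_closed_segment:
  assumes "unit_normal (closed_segment a b) n"
  shows "n \<noteq> 0" "n \<bullet> (b - a) = 0"
  using assms by (auto simp: unit_normal_def)

lemma unit_tangent_normal_exist:
  fixes a b :: "real^2"
  assumes "a \<noteq> b"
  obtains t n where "unit_tangent (closed_segment a b) t" "unit_normal (closed_segment a b) n"
proof
  show "unit_tangent (closed_segment a b) ((1 / norm (b - a)) *\<^sub>R (b - a))"
  proof -
    have "b - a \<in> {x - y | x y. x \<in> closed_segment a b \<and> y \<in> closed_segment a b}" by blast
    then have "(1 / norm (b - a)) *\<^sub>R (b - a) \<in> span {x - y | x y. x \<in> closed_segment a b \<and> y \<in> closed_segment a b}"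
      by (intro span_scale span_base)
    then show ?thesis using assms by (simp add: unit_tangent_def)
  qed
  define m :: "real^2" where "m = (\<chi> i. if i = 1 then - (b - a)$2 else (b - a)$1)"
  have m: "m \<bullet> (b - a) = 0" by (simp add: m_def inner_vec_def sum_2 algebra_simps)
  have "m \<noteq> 0"
  proof
    assume "m = 0"
    then have "m$1 = 0" "m$2 = 0" by simp_all
    then show False using assms by (auto simp: m_def vec_eq_iff forall_2)
  qed
  moreover have "m \<bullet> (x - y) = 0" if xy: "x \<in> closed_segment a b" "y \<in> closed_segment a b" for x y
  proof -
    obtain s u where *: "x = a + s *\<^sub>R (b - a)" "y = a + u *\<^sub>R (b - a)" using xy by (metis in_closed_segmentE)
    have "x - y = (s - u) *\<^sub>R (b - a)" unfolding * by (simp add: algebra_simps)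
    then show ?thesis using m by simp
  qed
  ultimately show "unit_normal (closed_segment a b) ((1 / norm m) *\<^sub>R m)"
    by (auto simp: unit_normal_def)
qed

lemma inner_outer_mult: "t \<bullet> (outer u *v n) = (t \<bullet> u) * (u \<bullet> n)"
  by (simp add: inner_vec_def matrix_vector_mult_def sum_2 algebra_simps)

text \<open>The leading coefficient of \<open>s \<mapsto> cub C (1 - s) s 0\<close> is \<open>cub C (-1) 1 0\<close>, so up to a
  nonzero factor this is the leading coefficient of the tangential component on the edge from \<open>a\<close> to \<open>b\<close>.\<close>

definition edge_coeff :: "real^2 \<Rightarrow> real^2 \<Rightarrow> real^2 \<Rightarrow> cubic \<Rightarrow> cubic \<Rightarrow> real" where
  "edge_coeff a b c p q = ((b - a) \<bullet> (c - b)) * cub p (-1) 1 0 - ((b - a) \<bullet> (a - c)) * cub q (-1) 1 0"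

text \<open>Taylor expansion at s = 0: value, derivative in direction (-1, 1, 0), and leading
  coefficient; the coefficient of s^2 is what the value at s = 1 leaves over.\<close>

lemma cub_edge:
  "cub C (1 - s) s 0 = cub C 1 0 0 + (dcub C (-1) 1 0 1 0 0) * s
     + (cub C 0 1 0 - cub C 1 0 0 - dcub C (-1) 1 0 1 0 0 - cub C (-1) 1 0) * s\<^sup>2 + cub C (-1) 1 0 * s^3"
  by (cases C rule: cubic_cases) (simp add: power2_eq_square power3_eq_cube algebra_simps)

context triangle
begin

lemma edge_subset_K: "closed_segment a b \<subseteq> K"
  by (simp add: closed_segment_subset)

lemma bary_edge: "bary a b c (a + s *\<^sub>R (b - a)) = 1 - s" "bary b c a (a + s *\<^sub>R (b - a)) = s" "bary c a b (a + s *\<^sub>R (b - a)) = 0"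
  using bary_eqI[OF nondeg, of "a + s *\<^sub>R (b - a)" "1 - s" s 0] by (simp_all add: algebra_simps)

lemma normal_component_nonzero:
  assumes "n \<noteq> 0" "n \<bullet> (b - a) = 0"
  shows "(c - b) \<bullet> n \<noteq> 0"
proof
  assume "(c - b) \<bullet> n = 0"
  then have eq: "n$1 * (c - b)$1 + n$2 * (c - b)$2 = 0" "n$1 * (b - a)$1 + n$2 * (b - a)$2 = 0"
    using assms(2) by (simp_all add: inner_vec_def sum_2 mult.commute)
  have "n$1 * cross2 (b - a) (c - b) = (n$1 * (b - a)$1 + n$2 * (b - a)$2) * (c - b)$2 - (n$1 * (c - b)$1 + n$2 * (c - b)$2) * (b - a)$2"
    "n$2 * cross2 (b - a) (c - b) = (n$1 * (c - b)$1 + n$2 * (c - b)$2) * (b - a)$1 - (n$1 * (b - a)$1 + n$2 * (b - a)$2) * (c - b)$1"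
    by (simp_all add: cross2_def algebra_simps)
  then have "n$1 * cross2 (b - a) (c - b) = 0" "n$2 * cross2 (b - a) (c - b) = 0" unfolding eq by simp_all
  then have "n$1 = 0" "n$2 = 0" using nondeg cross2_edges by simp_all
  with assms(1) show False by (simp add: vec_eq_iff forall_2)
qed

text \<open>The edge vectors sum to zero and n is orthogonal to b - a, so c - b and a - c have
  opposite normal components. This gives the common factor and the minus sign.\<close>

lemma cubic_field_edge:
  assumes "n \<bullet> (b - a) = 0"
  shows "t \<bullet> (cubic_field a b c p q r (a + s *\<^sub>R (b - a)) *v n)
    = ((c - b) \<bullet> n) * ((t \<bullet> (c - b)) * cub p (1 - s) s 0 - (t \<bullet> (a - c)) * cub q (1 - s) s 0)"
proof -
  have n: "(b - a) \<bullet> n = 0" "(a - c) \<bullet> n = - ((c - b) \<bullet> n)"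
    using assms by (simp_all add: inner_commute[of n] inner_diff_left)
  have "t \<bullet> (cubic_field a b c p q r (a + s *\<^sub>R (b - a)) *v n)
    = cub p (1 - s) s 0 * (t \<bullet> (outer (c - b) *v n)) + cub q (1 - s) s 0 * (t \<bullet> (outer (a - c) *v n))
      + cub r (1 - s) s 0 * (t \<bullet> (outer (b - a) *v n))"
    unfolding cubic_field_def bary_edge
    by (simp add: matrix_vector_mult_add_rdistrib inner_add_right scaleR_matrix_vector_assoc[symmetric])
  then show ?thesis
    unfolding inner_outer_mult n by (simp add: algebra_simps)
qed

lemma tangential_edge_iff:
  "(\<forall>t n. unit_tangent (closed_segment a b) t \<longrightarrow> unit_normal (closed_segment a b) n \<longrightarrow>
      restr (closed_segment a b) (\<lambda>x. t \<bullet> (restr K (cubic_field a b c p q r) x *v n)) \<in> poly_space 2 (closed_segment a b) UNIV)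
    \<longleftrightarrow> edge_coeff a b c p q = 0" (is "?lhs \<longleftrightarrow> ?rhs")
proof -
  let ?e = "closed_segment a b"
  let ?f = "\<lambda>t n. restr ?e (\<lambda>x. t \<bullet> (restr K (cubic_field a b c p q r) x *v n))"
  define \<alpha> \<beta> where "\<alpha> = (b - a) \<bullet> (c - b)" and "\<beta> = (b - a) \<bullet> (a - c)"
  have f: "?f t n (a + s *\<^sub>R (b - a)) = ((c - b) \<bullet> n) * (\<rho> * (\<alpha> * cub p (1 - s) s 0 - \<beta> * cub q (1 - s) s 0))"
    if "t = \<rho> *\<^sub>R (b - a)" "unit_normal ?e n" "s \<in> {0..1}" for t n s \<rho>
  proof -
    have "?f t n (a + s *\<^sub>R (b - a)) = t \<bullet> (cubic_field a b c p q r (a + s *\<^sub>R (b - a)) *v n)"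
      using in_closed_segmentI[OF that(3), of a b] edge_subset_K by (auto simp: restr_def)
    also have "\<dots> = ((c - b) \<bullet> n) * (\<rho> * (\<alpha> * cub p (1 - s) s 0 - \<beta> * cub q (1 - s) s 0))"
      unfolding cubic_field_edge[OF unit_normal_closed_segment(2)[OF that(2)]] that(1) inner_scaleR_left \<alpha>_def \<beta>_def
      by (simp add: right_diff_distrib mult.assoc)
    finally show ?thesis .
  qed
  have lead: "\<alpha> * cub p (-1) 1 0 - \<beta> * cub q (-1) 1 0 = edge_coeff a b c p q"
    by (simp add: edge_coeff_def \<alpha>_def \<beta>_def)
  show ?thesis
  proof
    assume lhs: ?lhs
    obtain t n where tn: "unit_tangent ?e t" "unit_normal ?e n"
      using unit_tangent_normal_exist[OF distinct_vertices(1)] by blast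
    obtain \<rho> where \<rho>: "\<rho> \<noteq> 0" "t = \<rho> *\<^sub>R (b - a)" using unit_tangent_closed_segment[OF tn(1)] by blast
    have "?f t n \<in> poly_space 2 ?e UNIV" using lhs tn by blast
    from poly_space_2_third_difference[OF this in_closed_segmentI]
    have "?f t n (a + 0 *\<^sub>R (b - a)) - 3 * ?f t n (a + (1/3) *\<^sub>R (b - a)) + 3 * ?f t n (a + (2/3) *\<^sub>R (b - a))
      - ?f t n (a + 1 *\<^sub>R (b - a)) = 0" by simp
    moreover define F where "F s = \<alpha> * cub p (1 - s) s 0 - \<beta> * cub q (1 - s) s 0" for s
    have fF: "?f t n (a + s *\<^sub>R (b - a)) = (((c - b) \<bullet> n) * \<rho>) * F s" if "s \<in> {0..1}" for s
      unfolding F_def f[OF \<rho>(2) tn(2) that] by (simp only: mult.assoc)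
    have "?f t n (a + 0 *\<^sub>R (b - a)) = (((c - b) \<bullet> n) * \<rho>) * F 0"
      "?f t n (a + (1/3) *\<^sub>R (b - a)) = (((c - b) \<bullet> n) * \<rho>) * F (1/3)"
      "?f t n (a + (2/3) *\<^sub>R (b - a)) = (((c - b) \<bullet> n) * \<rho>) * F (2/3)"
      "?f t n (a + 1 *\<^sub>R (b - a)) = (((c - b) \<bullet> n) * \<rho>) * F 1"
      by (rule fF; simp)+
    ultimately have "(((c - b) \<bullet> n) * \<rho>) * (F 0 - 3 * F (1/3) + 3 * F (2/3) - F 1) = 0"
      by (simp only: right_diff_distrib distrib_left mult.left_commute[of 3])
    then have "F 0 - 3 * F (1/3) + 3 * F (2/3) - F 1 = 0"
      using \<rho>(1) normal_component_nonzero[OF unit_normal_closed_segment[OF tn(2)]] by simp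
    \<comment> \<open>The constant is -3! / 3^3 = -2/9, the value of this difference on s^3.\<close>
    moreover have "F 0 - 3 * F (1/3) + 3 * F (2/3) - F 1 = - (2/9) * (\<alpha> * cub p (-1) 1 0 - \<beta> * cub q (-1) 1 0)"
      unfolding F_def cub_edge by (simp add: power2_eq_square power3_eq_cube algebra_simps del: cub.simps dcub.simps)
    ultimately have "\<alpha> * cub p (-1) 1 0 - \<beta> * cub q (-1) 1 0 = 0" by simp
    then show ?rhs using lead by simp
  next
    assume rhs: ?rhs
    show ?lhs
    proof (intro allI impI)
      fix t n assume t: "unit_tangent ?e t" and n: "unit_normal ?e n"
      obtain \<rho> where \<rho>: "t = \<rho> *\<^sub>R (b - a)" using unit_tangent_closed_segment[OF t] by blast
      \<comment> \<open>The coefficients of 1, s and s^2 from \<open>cub_edge\<close>. On the edge s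
        is the coordinate \<open>bary b c a\<close>, so g below is a polynomial on the plane that
        agrees with the trace once its s^3 term is gone.\<close>
      define k where "k i = ((c - b) \<bullet> n) * \<rho> * (\<alpha> * (if i = 0 then cub p 1 0 0 else if i = 1 then dcub p (-1) 1 0 1 0 0
          else cub p 0 1 0 - cub p 1 0 0 - dcub p (-1) 1 0 1 0 0 - cub p (-1) 1 0)
        - \<beta> * (if i = 0 then cub q 1 0 0 else if i = 1 then dcub q (-1) 1 0 1 0 0
          else cub q 0 1 0 - cub q 1 0 0 - dcub q (-1) 1 0 1 0 0 - cub q (-1) 1 0))" for i :: nat
      define g where "g x = k 0 + k 1 * bary b c a x + k 2 * (bary b c a x)\<^sup>2" for x
      have "?f t n x = g x" if x: "x \<in> ?e" for x
      proof -
        obtain s where s: "s \<in> {0..1}" "x = a + s *\<^sub>R (b - a)" using x by (rule in_closed_segmentE)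
        have "?f t n x = ((c - b) \<bullet> n) * (\<rho> * (\<alpha> * cub p (1 - s) s 0 - \<beta> * cub q (1 - s) s 0))"
          unfolding s(2) by (rule f[OF \<rho> n s(1)])
        also have "\<dots> = g x + ((c - b) \<bullet> n) * \<rho> * (\<alpha> * cub p (-1) 1 0 - \<beta> * cub q (-1) 1 0) * s^3"
          unfolding g_def s(2) bary_edge cub_edge by (simp add: k_def algebra_simps del: cub.simps dcub.simps)
        finally show ?thesis using rhs lead by simp
      qed
      then have "?f t n = restr ?e g" by (auto simp: restr_def fun_eq_iff)
      moreover have "bary b c a \<in> polyfun2 1" using triangle.polyfun2_bary[OF rotate] .
      then have "g \<in> polyfun2 2"
        unfolding g_def using polyfun_mono[of 1 2] polyfun_power[of "bary b c a" _ _ 1 2]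
        by (intro polyfun_add polyfun_const polyfun_scale) auto
      ultimately show "?f t n \<in> poly_space 2 ?e UNIV" unfolding poly_space_UNIV_real by blast
    qed
  qed
qed

end

section \<open>Separation by edge traces and interior moments\<close>

lemma edge_integral_cong:
  assumes "\<And>s. s \<in> {0..1} \<Longrightarrow> f (a + s *\<^sub>R (b - a)) = g s"
  shows "edge_integral (closed_segment a b) f = dist a b * integral {0..1} g"
  unfolding edge_integral_closed_segment
  by (rule arg_cong[where f = "(*) (dist a b)"], rule Henstock_Kurzweil_Integration.integral_cong) (rule assms)

context triangle
begin

text \<open>Concluding for every real s, not only on the edge itself, makes the traces vanish as
  polynomials, so later they may be evaluated anywhere.\<close>

lemma edge_separation:
  fixes p q r n t
  defines "e \<equiv> closed_segment a b" and "F \<equiv> cubic_field a b c p q r"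
  assumes n: "unit_normal e n" and t: "unit_tangent e t" and lead: "edge_coeff a b c p q = 0"
    and Fa: "F a = 0" and Fb: "F b = 0"
    and nn: "\<And>g. g \<in> polyfun2 1 \<Longrightarrow> edge_integral e (\<lambda>x. (n \<bullet> (restr K F x *v n)) * restr e g x) = 0"
    and tn: "edge_integral e (\<lambda>x. (t \<bullet> (restr K F x *v n)) * restr e (\<lambda>_. 1) x) = 0"
  shows "cub p (1 - s) s 0 = 0" "cub q (1 - s) s 0 = 0"
proof -
  note n' = unit_normal_closed_segment[OF n[unfolded e_def]]
  define k where "k = (c - b) \<bullet> n"
  have k: "k \<noteq> 0" "n \<bullet> (c - b) = k" "n \<bullet> (a - c) = - k"
    using normal_component_nonzero[OF n'] n'(2)
    by (simp_all add: k_def inner_commute[of _ n] inner_diff_right)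
  obtain \<rho> where \<rho>: "\<rho> \<noteq> 0" "t = \<rho> *\<^sub>R (b - a)" using unit_tangent_closed_segment[OF t[unfolded e_def]] by blast
  define \<alpha> \<beta> where "\<alpha> = (b - a) \<bullet> (c - b)" and "\<beta> = (b - a) \<bullet> (a - c)"
  have "\<alpha> + \<beta> = - ((b - a) \<bullet> (b - a))" by (simp add: \<alpha>_def \<beta>_def algebra_simps)
  then have \<alpha>\<beta>: "\<alpha> + \<beta> \<noteq> 0" using distinct_vertices by simp
  define P where "P s = cub p (1 - s) s 0 + cub q (1 - s) s 0" for s
  define T where "T s = \<alpha> * cub p (1 - s) s 0 - \<beta> * cub q (1 - s) s 0" for s
  have nF: "n \<bullet> (F (a + s *\<^sub>R (b - a)) *v n) = k\<^sup>2 * P s" for s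
    unfolding F_def cubic_field_edge[OF n'(2)] k_def[symmetric] k P_def by (simp add: power2_eq_square algebra_simps)
  have tF: "t \<bullet> (F (a + s *\<^sub>R (b - a)) *v n) = k * \<rho> * T s" for s
    unfolding F_def cubic_field_edge[OF n'(2)] k_def[symmetric] \<rho>(2) inner_scaleR_left \<alpha>_def[symmetric] \<beta>_def[symmetric] T_def
    by (simp add: algebra_simps)
  have P01: "P 0 = 0" "P 1 = 0" using nF[of 0] nF[of 1] Fa Fb k by simp_all
  have T01: "T 0 = 0" "T 1 = 0" using tF[of 0] tF[of 1] Fa Fb k \<rho> by simp_all
  have Pint: "integral {0..1} (\<lambda>s. P s * g (a + s *\<^sub>R (b - a))) = 0" if g: "g \<in> polyfun2 1" for g
  proof -
    have "edge_integral e (\<lambda>x. (n \<bullet> (restr K F x *v n)) * restr e g x)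
      = dist a b * integral {0..1} (\<lambda>s. k\<^sup>2 * (P s * g (a + s *\<^sub>R (b - a))))"
      unfolding e_def
    proof (rule edge_integral_cong)
      fix s :: real assume "s \<in> {0..1}"
      then have "a + s *\<^sub>R (b - a) \<in> closed_segment a b" by (rule in_closed_segmentI)
      then show "n \<bullet> (restr K F (a + s *\<^sub>R (b - a)) *v n) * restr (closed_segment a b) g (a + s *\<^sub>R (b - a))
        = k\<^sup>2 * (P s * g (a + s *\<^sub>R (b - a)))"
        using edge_subset_K by (simp add: restr_def subset_iff nF)
    qed
    then show ?thesis using nn[OF g] k distinct_vertices by simp
  qed
  have "edge_integral e (\<lambda>x. (t \<bullet> (restr K F x *v n)) * restr e (\<lambda>_. 1) x)
      = dist a b * integral {0..1} (\<lambda>s. k * \<rho> * T s)"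
    unfolding e_def
  proof (rule edge_integral_cong)
    fix s :: real assume "s \<in> {0..1}"
    then have "a + s *\<^sub>R (b - a) \<in> closed_segment a b" by (rule in_closed_segmentI)
    then show "t \<bullet> (restr K F (a + s *\<^sub>R (b - a)) *v n) * restr (closed_segment a b) (\<lambda>_. 1) (a + s *\<^sub>R (b - a))
      = k * \<rho> * T s"
      using edge_subset_K by (simp add: restr_def subset_iff tF)
  qed
  then have Tint: "integral {0..1} T = 0"
    using tn k \<rho> distinct_vertices by simp
  define k1 k3 where "k1 = dcub p (-1) 1 0 1 0 0 + dcub q (-1) 1 0 1 0 0" and "k3 = cub p (-1) 1 0 + cub q (-1) 1 0"
  \<comment> \<open>A cubic vanishing at 0 and 1 is a combination of s - s^2 and s^3 - s^2.\<close>
  have P: "P s = k1 * (s - s\<^sup>2) + k3 * (s^3 - s\<^sup>2)" for s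
  proof -
    have "P s = P 0 + k1 * s + (P 1 - P 0 - k1 - k3) * s\<^sup>2 + k3 * s^3"
      unfolding P_def cub_edge k1_def k3_def by (simp add: algebra_simps del: cub.simps dcub.simps)
    then show ?thesis by (simp add: P01 algebra_simps)
  qed
  \<comment> \<open>The tests with 1 and with \<open>bary b c a\<close>, which is s on the edge,
    give 2 k1 = k3 and 5 k1 = 3 k3; these are independent.\<close>
  have "(\<lambda>_. 1) \<in> polyfun2 1" by (rule polyfun_const)
  from Pint[OF this] have "integral {0..1} (\<lambda>s. k1 * s + (- k1 - k3) * s\<^sup>2 + k3 * s^3 + 0 * s^4) = 0"
    by (simp add: P algebra_simps)
  then have P1: "k1 / 2 + (- k1 - k3) / 3 + k3 / 4 + 0 / 5 = 0" unfolding integral_quartic_01 .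
  have "bary b c a \<in> polyfun2 1" using triangle.polyfun2_bary[OF rotate] .
  from Pint[OF this] have "integral {0..1} (\<lambda>s. 0 * s + k1 * s\<^sup>2 + (- k1 - k3) * s^3 + k3 * s^4) = 0"
    unfolding bary_edge by (simp add: P algebra_simps power2_eq_square power3_eq_cube power4_eq_xxxx)
  then have "0 / 2 + k1 / 3 + (- k1 - k3) / 4 + k3 / 5 = 0" unfolding integral_quartic_01 .
  then have "5 * k1 = 3 * k3" by (simp add: field_simps)
  moreover have "2 * k1 = k3" using P1 by (simp add: field_simps)
  ultimately have "k1 = 0" "k3 = 0" by simp_all
  then have P0: "P s = 0" for s by (simp add: P)
  define j1 where "j1 = \<alpha> * dcub p (-1) 1 0 1 0 0 - \<beta> * dcub q (-1) 1 0 1 0 0"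
  have T: "T s = j1 * (s - s\<^sup>2)" for s
  proof -
    have "T s = T 0 + j1 * s + (T 1 - T 0 - j1 - edge_coeff a b c p q) * s\<^sup>2 + edge_coeff a b c p q * s^3"
      unfolding T_def cub_edge j1_def edge_coeff_def \<alpha>_def[symmetric] \<beta>_def[symmetric]
      by (simp add: algebra_simps del: cub.simps dcub.simps)
    then show ?thesis by (simp add: T01 lead algebra_simps)
  qed
  have "integral {0..1} (\<lambda>s. j1 * s + (- j1) * s\<^sup>2 + 0 * s^3 + 0 * s^4) = integral {0..1} T"
    by (rule arg_cong[where f = "integral {0..1}"]) (simp add: T fun_eq_iff algebra_simps)
  then have "j1 = 0" unfolding integral_quartic_01 Tint by simp
  then have T0: "T s = 0" for s by (simp add: T)
  have q: "cub q (1 - s) s 0 = - cub p (1 - s) s 0" using P0[of s] by (simp add: P_def)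
  with T0[of s] have "(\<alpha> + \<beta>) * cub p (1 - s) s 0 = 0" by (simp add: T_def algebra_simps)
  with \<alpha>\<beta> show "cub p (1 - s) s 0 = 0" by simp
  with q show "cub q (1 - s) s 0 = 0" by simp
qed

lemma tri_integral_eq_0_if_moments_eq_0:
  assumes "\<And>S. S \<in> sym_mats \<Longrightarrow> integral K (\<lambda>x. restr K (cubic_field a b c p q r) x \<bullet> restr K (\<lambda>_. S) x) = 0"
  shows "tri_integral a b c (cub p) = 0"
proof -
  \<comment> \<open>The symmetrised product of a - c and b - a, both turned by a right angle. Its
    Frobenius product with \<open>outer u\<close> contains the factors
    \<open>cross2 (a - c) u\<close> and \<open>cross2 (b - a) u\<close>, so it vanishes for two of
    the three basis matrices and isolates p.\<close>
  define S :: "real^2^2" where "S = (\<chi> i j. let J = (\<lambda>u i. if i = 1 then - u$2 else u$1) in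
    J (a - c) i * J (b - a) j + J (b - a) i * J (a - c) j)"
  have "S \<in> sym_mats" by (simp add: S_def sym_mats_def transpose_def vec_eq_iff algebra_simps)
  have *: "outer u \<bullet> S = 2 * (cross2 (a - c) u * cross2 (b - a) u)" for u
    by (simp add: S_def inner_vec_def sum_2 cross2_def algebra_simps)
  have "cross2 (a - c) (a - c) = 0" "cross2 (b - a) (b - a) = 0" by (simp_all add: cross2_def)
  moreover have "cross2 (a - c) (c - b) = - cross2 (b - a) (c - a)" by (simp add: cross2_def algebra_simps)
  ultimately have S: "cubic_field a b c p q r x \<bullet> S
      = - 2 * (cross2 (b - a) (c - a))\<^sup>2 * cub p (bary a b c x) (bary b c a x) (bary c a b x)" for x
    unfolding cubic_field_def inner_add_left inner_scaleR_left *
    by (simp add: cross2_edges power2_eq_square)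
  have "0 = integral K (\<lambda>x. restr K (cubic_field a b c p q r) x \<bullet> restr K (\<lambda>_. S) x)"
    using assms[OF \<open>S \<in> sym_mats\<close>] by simp
  also have "\<dots> = integral K (\<lambda>x. - 2 * (cross2 (b - a) (c - a))\<^sup>2 * cub p (bary a b c x) (bary b c a x) (bary c a b x))"
    by (rule Henstock_Kurzweil_Integration.integral_cong) (simp add: restr_def S)
  also have "\<dots> = - 2 * (cross2 (b - a) (c - a))\<^sup>2 * tri_integral a b c (cub p)"
    unfolding tri_integral_def by (rule integral_mult_right)
  finally show ?thesis using nondeg by simp
qed

lemma tri_integral_cub:
  obtains A where "0 < A" "\<And>a0 a1 a2 b0 b1 b2 c0 c1 c2 d. a0 = 0 \<Longrightarrow> a1 = 0 \<Longrightarrow> a2 = 0 \<Longrightarrow>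
    tri_integral a b c (cub (a0, a1, a2, b0, b1, b2, c0, c1, c2, d)) = A * (2 * (b0 + b1 + b2 + c0 + c1 + c2) + d)"
proof -
  obtain A where A: "0 < A" "tri_integral a b c (\<lambda>x y z. x * y * z) = A"
    "tri_integral a b c (\<lambda>x y z. y\<^sup>2 * z) = 2 * A" "tri_integral a b c (\<lambda>x y z. y * z\<^sup>2) = 2 * A"
    "tri_integral a b c (\<lambda>x y z. z\<^sup>2 * x) = 2 * A" "tri_integral a b c (\<lambda>x y z. z * x\<^sup>2) = 2 * A"
    "tri_integral a b c (\<lambda>x y z. x\<^sup>2 * y) = 2 * A" "tri_integral a b c (\<lambda>x y z. x * y\<^sup>2) = 2 * A"
    by (rule tri_integral_cubic_monomials[OF nondeg]) blast
  have "tri_integral a b c (cub (0, 0, 0, b0, b1, b2, c0, c1, c2, d)) = A * (2 * (b0 + b1 + b2 + c0 + c1 + c2) + d)"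
    for b0 b1 b2 c0 c1 c2 d
  proof -
    define G where "G x y z = b0 * (y\<^sup>2 * z) + b1 * (z\<^sup>2 * x) + b2 * (x\<^sup>2 * y)
     + c0 * (y * z\<^sup>2) + c1 * (z * x\<^sup>2) + c2 * (x * y\<^sup>2) + d * (x * y * z)" for x y z
    have "cub (0, 0, 0, b0, b1, b2, c0, c1, c2, d) = G"
      by (simp add: fun_eq_iff G_def)
    moreover have "tri_integral a b c G
      = b0 * (2 * A) + b1 * (2 * A) + b2 * (2 * A) + c0 * (2 * A) + c1 * (2 * A) + c2 * (2 * A) + d * A"
      unfolding G_def[abs_def] by (subst tri_integral_add, (intro cont3_intros)+)+ (simp only: tri_integral_cmul A)
    ultimately show ?thesis by (simp add: algebra_simps)
  qed
  with A(1) show thesis using that by blast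
qed

end

lemma tri_integral_rot_cubic: "tri_integral b c a (cub (rot_cubic C)) = tri_integral a b c (cub C)"
  unfolding tri_integral_def cub_rot_cubic by (simp add: insert_commute)

text \<open>Four points determine a cubic in s: s = 0 and s = 1 give a0 and a1, and then s = 1/2 and
  s = 2 give independent equations for b2 and c2.\<close>

lemma cub_edge_eq_0D:
  assumes "\<And>s. cub (a0, a1, a2, b0, b1, b2, c0, c1, c2, d) (1 - s) s 0 = 0"
  shows "a0 = 0" "a1 = 0" "b2 = 0" "c2 = 0"
  using assms[of 0] assms[of 1] assms[of "1/2"] assms[of 2] by (simp_all add: power2_eq_square power3_eq_cube)

context triangle
begin

lemma cubic_separation:
  assumes edges: "\<And>s. cub p (1 - s) s 0 = 0" "\<And>s. cub q (1 - s) s 0 = 0"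
      "\<And>s. cub q 0 (1 - s) s = 0" "\<And>s. cub r 0 (1 - s) s = 0"
      "\<And>s. cub r s 0 (1 - s) = 0" "\<And>s. cub p s 0 (1 - s) = 0"
    and moments: "tri_integral a b c (cub p) = 0" "tri_integral a b c (cub q) = 0" "tri_integral a b c (cub r) = 0"
    and div: "div_coeffs (p, q, r) 1 (-1) 0 = 0" "div_coeffs (p, q, r) 0 1 (-1) = 0" "div_coeffs (p, q, r) 1 0 (-1) = 0"
  shows "p = 0 \<and> q = 0 \<and> r = 0"
proof -
  obtain pa0 pa1 pa2 pb0 pb1 pb2 pc0 pc1 pc2 pd where p: "p = (pa0, pa1, pa2, pb0, pb1, pb2, pc0, pc1, pc2, pd)"
    by (cases p rule: cubic_cases)
  obtain qa0 qa1 qa2 qb0 qb1 qb2 qc0 qc1 qc2 qd where q: "q = (qa0, qa1, qa2, qb0, qb1, qb2, qc0, qc1, qc2, qd)"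
    by (cases q rule: cubic_cases)
  obtain ra0 ra1 ra2 rb0 rb1 rb2 rc0 rc1 rc2 rd where r: "r = (ra0, ra1, ra2, rb0, rb1, rb2, rc0, rc1, rc2, rd)"
    by (cases r rule: cubic_cases)
  have rots: "cub C 0 (1 - s) s = cub (rot_cubic C) (1 - s) s 0" "cub C s 0 (1 - s) = cub (rot_cubic (rot_cubic C)) (1 - s) s 0" for C s
    by (simp_all add: cub_rot_cubic)
  note e = edges[unfolded rots p q r rot_cubic.simps]
  note z = e[THEN cub_edge_eq_0D(1)] e[THEN cub_edge_eq_0D(2)] e[THEN cub_edge_eq_0D(3)] e[THEN cub_edge_eq_0D(4)]
  obtain A where A: "0 < A" "\<And>a0 a1 a2 b0 b1 b2 c0 c1 c2 d. a0 = 0 \<Longrightarrow> a1 = 0 \<Longrightarrow> a2 = 0 \<Longrightarrow>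
    tri_integral a b c (cub (a0, a1, a2, b0, b1, b2, c0, c1, c2, d)) = A * (2 * (b0 + b1 + b2 + c0 + c1 + c2) + d)"
    using tri_integral_cub by blast
  \<comment> \<open>Vanishing on two edges makes p divisible by y z, and q, r cyclically, so three
    coefficients of each survive; the zero mean, with its ratio 2 between moments, eliminates one
    more.\<close>
  have "pd = - 2 * (pb0 + pc0)" "qd = - 2 * (qb1 + qc1)" "rd = - 2 * (rb2 + rc2)"
    using moments A(1) by (simp_all add: p q r A(2) z)
  \<comment> \<open>Let E0, E1, E2 be the values of the divergence form of p in the directions (0,
    1, -1), (1, 0, -1), (1, -1, 0). They are 3 (pb0 - pc0), -(2 pb0 + 3 pc0) and 3 pb0 + 2 pc0, so
    E0 = 3 (E1 + E2); q and r satisfy the cyclic analogues. The constraint equates the three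
    triples, hence E0 = E1 = E2 = 6 E0 = 0, which forces pb0 = pc0 = 0 and likewise for q and
    r.\<close>
  with div show ?thesis
    by (simp add: p q r z div_coeffs_def prod_eq_iff zero_prod_def)
qed

end

section \<open>Unisolvence\<close>

lemma card_le_if_basis_of:
  assumes "basis_of B V" "V \<subseteq> span S" "finite S"
  shows "finite B" "card B \<le> card S"
  using independent_span_bound[OF assms(3), of B] assms(1,2) span_superset[of B]
  unfolding basis_of_def by blast+

lemma basis_of_subset: "basis_of B V \<Longrightarrow> B \<subseteq> V"
  using span_superset[of B] unfolding basis_of_def by blast

lemma polyfun2_1_segment:
  assumes "g \<in> polyfun2 1"
  shows "g (a + s *\<^sub>R (b - a)) = g a + s * (g b - g a)"
  using assms
proof (induction rule: polyfun_induct)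
  case (monomial i j)
  then have "i = 0 \<and> j = 0 \<or> i = 1 \<and> j = 0 \<or> i = 0 \<and> j = 1" by arith
  then show ?case by (elim disjE) (simp_all add: algebra_simps)
next
  case (add f g)
  show ?case unfolding add by (simp add: algebra_simps)
next
  case (scale c f)
  show ?case unfolding scale by (simp add: algebra_simps)
qed simp

lemma continuous_on_poly_space:
  assumes "f \<in> poly_space k D UNIV" shows "continuous_on D (f :: _ \<Rightarrow> real)"
  using assms continuous_on_polyfun2 continuous_on_restr unfolding poly_space_UNIV_real by blast

lemma continuous_on_quadratic_form:
  assumes "continuous_on A M"
  shows "continuous_on A (\<lambda>x. w \<bullet> (M x *v n :: real^2))"
proof -
  have "linear (\<lambda>M. w \<bullet> (M *v n :: real^2))"
    by (rule linearI) (simp_all add: matrix_vector_mult_add_rdistrib inner_add_right scaleR_matrix_vector_assoc[symmetric])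
  then have "continuous_on UNIV (\<lambda>M. w \<bullet> (M *v n :: real^2))"
    by (simp add: linear_continuous_on linear_conv_bounded_linear)
  then show ?thesis using continuous_on_compose2[OF _ assms] by auto
qed

lemma continuous_on_segment_param:
  fixes a b :: "'a::real_normed_vector"
  shows "continuous_on (closed_segment a b) f \<Longrightarrow> continuous_on {0..1} (\<lambda>s. f (a + s *\<^sub>R (b - a)))"
proof (rule continuous_on_compose2[where g = f and t = "closed_segment a b"])
  show "continuous_on {0..1} (\<lambda>s. a + s *\<^sub>R (b - a))" by (intro continuous_intros)
  show "(\<lambda>s. a + s *\<^sub>R (b - a)) ` {0..1} \<subseteq> closed_segment a b" using in_closed_segmentI by blast
qed

lemma linear_edge_integral:
  assumes f: "\<And>C. continuous_on (closed_segment a b) (f C)" and lin: "\<And>x. linear (\<lambda>C. f C x)"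
  shows "linear (\<lambda>C. edge_integral (closed_segment a b) (f C))"
proof (rule linearI)
  have int: "(\<lambda>s. f C (a + s *\<^sub>R (b - a))) integrable_on {0..1}" for C
    by (intro integrable_continuous_real continuous_on_segment_param f)
  show "edge_integral (closed_segment a b) (f (C + C')) = edge_integral (closed_segment a b) (f C) + edge_integral (closed_segment a b) (f C')" for C C'
    unfolding edge_integral_closed_segment linear_add[OF lin]
    by (simp add: Henstock_Kurzweil_Integration.integral_add[OF int int] distrib_left)
  show "edge_integral (closed_segment a b) (f (k *\<^sub>R C)) = k *\<^sub>R edge_integral (closed_segment a b) (f C)" for k C
    unfolding edge_integral_closed_segment linear_scale[OF lin] by simp
qed

lemma linear_integral_compact:
  fixes f :: "'c::real_vector \<Rightarrow> 'a::euclidean_space \<Rightarrow> real"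
  assumes "compact S" and f: "\<And>C. continuous_on S (f C)" and lin: "\<And>x. linear (\<lambda>C. f C x)"
  shows "linear (\<lambda>C. integral S (f C))"
proof (rule linearI)
  have int: "f C integrable_on S" for C
    by (intro integrable_on_continuous_compact(2) assms)
  show "integral S (f (C + C')) = integral S (f C) + integral S (f C')" for C C'
  proof -
    have "f (C + C') = (\<lambda>x. f C x + f C' x)" using linear_add[OF lin] by blast
    then show ?thesis using Henstock_Kurzweil_Integration.integral_add[OF int int, of C C'] by simp
  qed
  show "integral S (f (k *\<^sub>R C)) = k *\<^sub>R integral S (f C)" for k C
  proof -
    have "f (k *\<^sub>R C) = (\<lambda>x. k *\<^sub>R f C x)" using linear_scale[OF lin] by blast
    then show ?thesis by simp
  qed
qed

lemma edge_integral_eq_0_span: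
  assumes f: "continuous_on (closed_segment a b) f" and B: "\<And>q. q \<in> B \<Longrightarrow> continuous_on (closed_segment a b) q"
    and 0: "\<And>q. q \<in> B \<Longrightarrow> edge_integral (closed_segment a b) (\<lambda>x. f x * q x) = 0" and q: "q \<in> span B"
  shows "edge_integral (closed_segment a b) (\<lambda>x. f x * q x) = 0"
proof -
  let ?e = "closed_segment a b"
  have int: "(\<lambda>s. f (a + s *\<^sub>R (b - a)) * q (a + s *\<^sub>R (b - a))) integrable_on {0..1}" if "continuous_on ?e q" for q
    using that f by (intro integrable_continuous_real continuous_intros continuous_on_segment_param)
  \<comment> \<open>Continuity is part of the subspace because additivity of the integral rests on
    integrability.\<close>
  define T where "T = {q. continuous_on ?e q \<and> edge_integral ?e (\<lambda>x. f x * q x) = 0}"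
  have "subspace T"
  proof (rule subspaceI)
    show "0 \<in> T" by (simp add: T_def edge_integral_closed_segment zero_fun_def)
    show "x + y \<in> T" if "x \<in> T" "y \<in> T" for x y
    proof -
      have cont: "continuous_on ?e x" "continuous_on ?e y" using that by (auto simp: T_def)
      have "edge_integral ?e (\<lambda>z. f z * (x z + y z)) = edge_integral ?e (\<lambda>z. f z * x z) + edge_integral ?e (\<lambda>z. f z * y z)"
        unfolding edge_integral_closed_segment distrib_left
        by (simp add: Henstock_Kurzweil_Integration.integral_add[OF int[OF cont(1)] int[OF cont(2)]] distrib_left)
      then show ?thesis using that by (auto simp: T_def plus_fun_def intro: continuous_on_add)
    qed
    show "k *\<^sub>R x \<in> T" if "x \<in> T" for k x
    proof -
      have "edge_integral ?e (\<lambda>z. f z * (k * x z)) = k * edge_integral ?e (\<lambda>z. f z * x z)"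
        unfolding edge_integral_closed_segment mult.left_commute[of _ k] by simp
      then show ?thesis using that by (auto simp: T_def scaleR_fun_def intro: continuous_intros)
    qed
  qed
  moreover have "B \<subseteq> T" using B 0 by (auto simp: T_def)
  ultimately show ?thesis using span_minimal[of B T] q by (auto simp: T_def)
qed

lemma integral_inner_eq_0_span:
  fixes f :: "'a::euclidean_space \<Rightarrow> 'b::euclidean_space"
  assumes S: "compact S" and f: "continuous_on S f" and B: "\<And>q. q \<in> B \<Longrightarrow> continuous_on S q"
    and 0: "\<And>q. q \<in> B \<Longrightarrow> integral S (\<lambda>x. f x \<bullet> q x) = 0" and q: "q \<in> span B"
  shows "integral S (\<lambda>x. f x \<bullet> q x) = 0"
proof -
  have int: "(\<lambda>x. f x \<bullet> q x) integrable_on S" if "continuous_on S q" for q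
    using that f by (intro integrable_on_continuous_compact(2)[OF S] continuous_intros)
  define T where "T = {q. continuous_on S q \<and> integral S (\<lambda>x. f x \<bullet> q x) = 0}"
  have "subspace T"
  proof (rule subspaceI)
    show "0 \<in> T" by (simp add: T_def zero_fun_def)
    show "x + y \<in> T" if "x \<in> T" "y \<in> T" for x y
    proof -
      have cont: "continuous_on S x" "continuous_on S y" using that by (auto simp: T_def)
      show ?thesis using that Henstock_Kurzweil_Integration.integral_add[OF int[OF cont(1)] int[OF cont(2)]]
        by (auto simp: T_def plus_fun_def inner_add_right intro: continuous_on_add)
    qed
    show "k *\<^sub>R x \<in> T" if "x \<in> T" for k x
      using that by (auto simp: T_def scaleR_fun_def intro: continuous_intros)
  qed
  moreover have "B \<subseteq> T" using B 0 by (auto simp: T_def)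
  ultimately show ?thesis using span_minimal[of B T] q by (auto simp: T_def)
qed

section \<open>The constraint map and the parametrised fields\<close>

lemma rot_cubic_add: "rot_cubic (C + C') = rot_cubic C + rot_cubic C'"
  by (cases C rule: cubic_cases; cases C' rule: cubic_cases) simp

lemma rot_cubic_scale: "rot_cubic (k *\<^sub>R C) = k *\<^sub>R rot_cubic C"
  by (cases C rule: cubic_cases) simp

text \<open>The codomain has dimension nine, as the count requires. The second and third edge are
  rotated into the position of the first, where \<open>edge_coeff\<close> applies.\<close>

definition constraint :: "real^2 \<Rightarrow> real^2 \<Rightarrow> real^2 \<Rightarrow> cubic \<times> cubic \<times> cubic \<Rightarrow>
    ((real \<times> real) \<times> (real \<times> real) \<times> (real \<times> real)) \<times> real \<times> real \<times> real" where
  "constraint a b c C = (case C of (p, q, r) \<Rightarrow>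
    ((div_coeffs C 1 (-1) 0, div_coeffs C 0 1 (-1), div_coeffs C 1 0 (-1)),
     edge_coeff a b c p q, edge_coeff b c a (rot_cubic q) (rot_cubic r),
     edge_coeff c a b (rot_cubic (rot_cubic r)) (rot_cubic (rot_cubic p))))"

lemma linear_div_coeffs: "linear (\<lambda>C. div_coeffs C x y z)"
  by (rule linearI)
    (simp_all add: div_coeffs_def linear_add[OF linear_dcub] linear_scale[OF linear_dcub] case_prod_beta right_diff_distrib)

lemma linear_constraint: "linear (constraint a b c)"
proof (rule linearI)
  note [simp] = cub_simps rot_cubic_add rot_cubic_scale
  have add: "edge_coeff a b c (p + p') (q + q') = edge_coeff a b c p q + edge_coeff a b c p' q'" for a b c p q p' q'
    by (simp add: edge_coeff_def algebra_simps)
  have scale: "edge_coeff a b c (k *\<^sub>R p) (k *\<^sub>R q) = k * edge_coeff a b c p q" for a b c k p q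
    by (simp add: edge_coeff_def algebra_simps)
  show "constraint a b c (C + C') = constraint a b c C + constraint a b c C'" for C C'
  proof -
    obtain p q r p' q' r' where C: "C = (p, q, r)" "C' = (p', q', r')" by (metis prod.exhaust)
    have "div_coeffs (p + p', q + q', r + r') x y z = div_coeffs C x y z + div_coeffs C' x y z" for x y z
      using linear_add[OF linear_div_coeffs, of C C'] by (simp add: C)
    then show ?thesis unfolding constraint_def C by (simp add: add)
  qed
  show "constraint a b c (k *\<^sub>R C) = k *\<^sub>R constraint a b c C" for k C
  proof -
    obtain p q r where C: "C = (p, q, r)" by (metis prod.exhaust)
    have "div_coeffs (k *\<^sub>R p, k *\<^sub>R q, k *\<^sub>R r) x y z = k *\<^sub>R div_coeffs C x y z" for x y z
      using linear_scale[OF linear_div_coeffs, of k C] by (simp add: C)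
    then show ?thesis unfolding constraint_def C by (simp add: scale)
  qed
qed

definition cubic_field_on :: "real^2 \<Rightarrow> real^2 \<Rightarrow> real^2 \<Rightarrow> cubic \<times> cubic \<times> cubic \<Rightarrow> real^2 \<Rightarrow> real^2^2" where
  "cubic_field_on a b c C = (case C of (p, q, r) \<Rightarrow> restr (convex hull {a, b, c}) (cubic_field a b c p q r))"

lemma linear_cubic_field_on: "linear (cubic_field_on a b c)"
proof (rule linearI)
  show "cubic_field_on a b c (C + C') = cubic_field_on a b c C + cubic_field_on a b c C'" for C C'
  proof -
    obtain p q r p' q' r' where C: "C = (p, q, r)" "C' = (p', q', r')" by (metis prod.exhaust)
    show ?thesis unfolding C cubic_field_on_def restr_def cubic_field_def
      by (simp add: fun_eq_iff cub_simps scaleR_add_left del: cub.simps)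
  qed
  show "cubic_field_on a b c (k *\<^sub>R C) = k *\<^sub>R cubic_field_on a b c C" for k C
  proof -
    obtain p q r where C: "C = (p, q, r)" by (metis prod.exhaust)
    show ?thesis unfolding C cubic_field_on_def restr_def cubic_field_def
      by (simp add: fun_eq_iff cub_simps scaleR_fun_def scaleR_add_right del: cub.simps)
  qed
qed

lemma linear_cubic_field_on_apply: "linear (\<lambda>C. cubic_field_on a b c C x)"
  by (rule linearI) (simp_all add: linear_add[OF linear_cubic_field_on] linear_scale[OF linear_cubic_field_on] scaleR_fun_def)

context triangle
begin

lemma continuous_on_cubic_field: "continuous_on A (cubic_field a b c p q r)"
  unfolding cubic_field_def[abs_def] by (intro continuous_intros cont3_bary cont3_cub)

lemma continuous_on_cubic_field_on: "A \<subseteq> K \<Longrightarrow> continuous_on A (cubic_field_on a b c C)"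
  unfolding cubic_field_on_def
  by (rule continuous_on_subset[of K]) (auto split: prod.split intro: continuous_on_restr continuous_on_cubic_field)

lemma Sigma_space_K: "Sigma_space K = cubic_field_on a b c ` {C. constraint a b c C = 0}"
proof -
  interpret rot: triangle b c a by (rule rotate)
  interpret rot': triangle c a b by (rule rot.rotate)
  have hull: "convex hull {b, c, a} = K" "convex hull {c, a, b} = K" by (simp_all add: insert_commute)
  have mem: "restr K (cubic_field a b c p q r) \<in> Sigma_space K \<longleftrightarrow> constraint a b c (p, q, r) = 0" for p q r
  proof -
    have poly: "restr K (cubic_field a b c p q r) \<in> poly_space 3 K sym_mats"
      unfolding poly_space_3_sym_mats by blast
    have rot2: "cubic_field c a b (rot_cubic (rot_cubic r)) (rot_cubic (rot_cubic p)) (rot_cubic (rot_cubic q)) = cubic_field a b c p q r"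
      by (simp add: cubic_field_rotate)
    define Q where "Q e \<longleftrightarrow> (\<forall>t n. unit_tangent e t \<longrightarrow> unit_normal e n \<longrightarrow>
      restr e (\<lambda>x. t \<bullet> (restr K (cubic_field a b c p q r) x *v n)) \<in> poly_space 2 e UNIV)" for e
    \<comment> \<open>Equal hulls and \<open>cubic_field_rotate\<close> turn the statements about
      the rotated triangles into statements about the same field on the same set.\<close>
    note iffs = tangential_edge_iff[of p q r]
      rot.tangential_edge_iff[of "rot_cubic q" "rot_cubic r" "rot_cubic p", unfolded hull cubic_field_rotate]
      rot'.tangential_edge_iff[of "rot_cubic (rot_cubic r)" "rot_cubic (rot_cubic p)" "rot_cubic (rot_cubic q)", unfolded hull rot2]
    have "restr K (cubic_field a b c p q r) \<in> Sigma_space K \<longleftrightarrow>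
      row_div K (restr K (cubic_field a b c p q r)) \<in> poly_space 1 K UNIV \<and> (\<forall>e. e edge_of K \<longrightarrow> Q e)"
      unfolding Sigma_space_def Q_def using poly by blast
    also have "(\<forall>e. e edge_of K \<longrightarrow> Q e) \<longleftrightarrow> Q (closed_segment a b) \<and> Q (closed_segment b c) \<and> Q (closed_segment c a)"
      unfolding edge_of_K_iff by blast
    also have "row_div K (restr K (cubic_field a b c p q r)) \<in> poly_space 1 K UNIV \<and> \<dots> \<longleftrightarrow> constraint a b c (p, q, r) = 0"
      unfolding iffs[folded Q_def] row_div_in_poly_space_1_iff by (simp add: constraint_def zero_prod_def)
    finally show ?thesis .
  qed
  have on: "cubic_field_on a b c (p, q, r) = restr K (cubic_field a b c p q r)" for p q r
    by (simp add: cubic_field_on_def)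
  show ?thesis
  proof (intro equalityI subsetI)
    fix \<tau> assume \<tau>: "\<tau> \<in> Sigma_space K"
    then have "\<tau> \<in> {restr K (cubic_field a b c p q r) | p q r. True}"
      unfolding poly_space_3_sym_mats[symmetric] Sigma_space_def by blast
    then obtain p q r where pqr: "\<tau> = cubic_field_on a b c (p, q, r)" unfolding on by blast
    have "constraint a b c (p, q, r) = 0" using \<tau> unfolding pqr on mem .
    then show "\<tau> \<in> cubic_field_on a b c ` {C. constraint a b c C = 0}" unfolding pqr by blast
  next
    fix \<tau> assume "\<tau> \<in> cubic_field_on a b c ` {C. constraint a b c C = 0}"
    then obtain C where C: "\<tau> = cubic_field_on a b c C" "constraint a b c C = 0" by blast
    obtain p q r where pqr: "C = (p, q, r)" by (metis prod.exhaust)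
    show "\<tau> \<in> Sigma_space K" using C(2) unfolding C(1) pqr on mem .
  qed
qed

text \<open>On the edge an affine function is interpolated from its two endpoint values, so two
  functions span although an affine function on the plane has three coefficients.\<close>

lemma poly_space_1_edge:
  "poly_space 1 (closed_segment a b) UNIV \<subseteq> span {restr (closed_segment a b) (\<lambda>_. 1), restr (closed_segment a b) (bary b c a)}"
proof
  let ?e = "closed_segment a b"
  fix f :: "real^2 \<Rightarrow> real" assume "f \<in> poly_space 1 ?e UNIV"
  then obtain g where g: "g \<in> polyfun2 1" "f = restr ?e g" unfolding poly_space_UNIV_real by blast
  have "f = g a *\<^sub>R restr ?e (\<lambda>_. 1) + (g b - g a) *\<^sub>R restr ?e (bary b c a)"
  proof
    fix x
    show "f x = (g a *\<^sub>R restr ?e (\<lambda>_. 1) + (g b - g a) *\<^sub>R restr ?e (bary b c a)) x"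
    proof (cases "x \<in> ?e")
      case True
      then obtain s where s: "x = a + s *\<^sub>R (b - a)" by (rule in_closed_segmentE)
      have "g x = g a + (g b - g a) * bary b c a x" unfolding s polyfun2_1_segment[OF g(1)] bary_edge by simp
      with True show ?thesis by (simp add: g(2) restr_def scaleR_fun_def)
    qed (simp add: g(2) restr_def scaleR_fun_def)
  qed
  then show "f \<in> span {restr ?e (\<lambda>_. 1), restr ?e (bary b c a)}"
    by (simp only:) (intro span_add span_scale span_base; simp)
qed

end

lemma poly_space_0: "f \<in> poly_space 0 D X \<longleftrightarrow> (\<exists>c\<in>X. f = restr D (\<lambda>_. c))"
proof
  assume "f \<in> poly_space 0 D X"
  then show "\<exists>c\<in>X. f = restr D (\<lambda>_. c)" by (auto simp: poly_space_def)
next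
  assume "\<exists>c\<in>X. f = restr D (\<lambda>_. c)"
  then obtain c where "c \<in> X" "f = restr D (\<lambda>_. c)" by blast
  then show "f \<in> poly_space 0 D X" unfolding poly_space_def by (intro CollectI exI[of _ "\<lambda>_ _. c"]) simp
qed

lemma poly_space_0_real_subset_span: "poly_space 0 D UNIV \<subseteq> span {restr D (\<lambda>_. 1 :: real)}"
proof
  fix f :: "real^2 \<Rightarrow> real" assume "f \<in> poly_space 0 D UNIV"
  then obtain k where "f = restr D (\<lambda>_. k)" unfolding poly_space_0 by blast
  then have "f = k *\<^sub>R restr D (\<lambda>_. 1)" by (auto simp: restr_def scaleR_fun_def fun_eq_iff)
  then show "f \<in> span {restr D (\<lambda>_. 1)}" by (simp only:) (intro span_scale span_base; simp)
qed

section \<open>Counting and separation of the degrees of freedom\<close>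

context triangle
begin

lemma poly_space_0_sym_mats_subset_span:
  "poly_space 0 K sym_mats \<subseteq> span ((\<lambda>u. restr K (\<lambda>_. outer u)) ` {c - b, a - c, (c - b) + (a - c)})"
proof
  fix f assume "f \<in> poly_space 0 K sym_mats"
  then obtain A where A: "A \<in> sym_mats" "f = restr K (\<lambda>_. A)" unfolding poly_space_0 by blast
  obtain p q r where "A = p *\<^sub>R outer (c - b) + q *\<^sub>R outer (a - c) + r *\<^sub>R outer ((c - b) + (a - c))"
    using sym_mats_outer[OF A(1), of "c - b" "a - c"] nondeg cross2_edges by auto
  then have "f = p *\<^sub>R restr K (\<lambda>_. outer (c - b)) + q *\<^sub>R restr K (\<lambda>_. outer (a - c))
      + r *\<^sub>R restr K (\<lambda>_. outer ((c - b) + (a - c)))"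
    by (simp add: A(2) restr_def scaleR_fun_def fun_eq_iff)
  then show "f \<in> span ((\<lambda>u. restr K (\<lambda>_. outer u)) ` {c - b, a - c, (c - b) + (a - c)})"
    by (simp only:) (intro span_add span_scale span_base; blast)
qed


text \<open>Each basis is bounded through an explicit spanning set of its test space. Three vertices
  with 3 entries, three edges with 2 and with 1 test functions, and 3 interior ones give 9 + 6 + 3 +
  3.\<close>

lemma finite_card_dofs:
  assumes "\<And>e. e edge_of K \<Longrightarrow> basis_of (B1 e) (poly_space 1 e UNIV)"
    and "\<And>e. e edge_of K \<Longrightarrow> basis_of (B0 e) (poly_space 0 e UNIV)"
    and "basis_of BK (poly_space 0 K sym_mats)"
  shows "finite (dofs K B1 B0 BK)" "card (dofs K B1 B0 BK) \<le> 21"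
proof -
  interpret rot: triangle b c a by (rule rotate)
  interpret rot': triangle c a b by (rule rot.rotate)
  define E where "E = {closed_segment a b, closed_segment b c, closed_segment c a}"
  have E: "e \<in> E \<longleftrightarrow> e edge_of K" for e unfolding E_def edge_of_K_iff by blast
  have finE: "finite E" "card E \<le> 3" unfolding E_def by (simp_all add: card_insert_if)
  have B1: "finite (B1 e) \<and> card (B1 e) \<le> 2" if e: "e \<in> E" for e
  proof -
    obtain f g where sub: "poly_space 1 e UNIV \<subseteq> span {f, g :: real^2 \<Rightarrow> real}"
      using e poly_space_1_edge rot.poly_space_1_edge rot'.poly_space_1_edge unfolding E_def by blast
    have "card {f, g} \<le> 2" by (simp add: card_insert_if)
    then show ?thesis using card_le_if_basis_of[OF assms(1)[OF e[unfolded E]] sub] by simp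
  qed
  have B0: "finite (B0 e) \<and> card (B0 e) \<le> 1" if e: "e \<in> E" for e
    using card_le_if_basis_of[OF assms(2)[OF e[unfolded E]] poly_space_0_real_subset_span] by simp
  have "card ((\<lambda>u. restr K (\<lambda>_. outer u)) ` {c - b, a - c, (c - b) + (a - c)}) \<le> card {c - b, a - c, (c - b) + (a - c)}"
    by (rule card_image_le) simp
  also have "\<dots> \<le> 3" by (simp add: card_insert_if)
  finally have BK: "finite BK" "card BK \<le> 3"
    using card_le_if_basis_of[OF assms(3) poly_space_0_sym_mats_subset_span] by auto
  let ?V = "(\<lambda>(v, ij). Vertex_value v ij) ` ({a, b, c} \<times> {(1, 1), (1, 2), (2, 2)})"
  let ?N = "\<Union>e\<in>E. Edge_nn e ` B1 e" and ?T = "\<Union>e\<in>E. Edge_tn e ` B0 e"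
  have dofs: "dofs K B1 B0 BK = ?V \<union> ?N \<union> ?T \<union> Interior ` BK"
    unfolding dofs_def extreme_point_of_K_iff E[symmetric] by (auto simp: image_iff)
  show "finite (dofs K B1 B0 BK)"
    unfolding dofs using finE B1 B0 BK by auto
  have "card ?V \<le> card ({a, b, c} \<times> {(1 :: 2, 1 :: 2), (1, 2), (2, 2)})" by (rule card_image_le) simp
  also have "\<dots> \<le> 9"
    using mult_le_mono[of "card {a, b, c}" 3 "card {(1 :: 2, 1 :: 2), (1, 2), (2, 2)}" 3]
    by (simp add: card_insert_if card_cartesian_product)
  finally have V: "card ?V \<le> 9" .
  have "card ?N \<le> (\<Sum>e\<in>E. card (Edge_nn e ` B1 e))" by (rule card_UN_le[OF finE(1)])
  also have "\<dots> \<le> (\<Sum>e\<in>E. 2)" using B1 by (intro sum_mono) (meson card_image_le order_trans)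
  finally have N: "card ?N \<le> 6" using finE by simp
  have "card ?T \<le> (\<Sum>e\<in>E. card (Edge_tn e ` B0 e))" by (rule card_UN_le[OF finE(1)])
  also have "\<dots> \<le> (\<Sum>e\<in>E. 1)" using B0 by (intro sum_mono) (meson card_image_le order_trans)
  finally have T: "card ?T \<le> 3" using finE by simp
  have "card (Interior ` BK) \<le> 3" using BK card_image_le[of BK Interior] by simp
  with V N T show "card (dofs K B1 B0 BK) \<le> 21"
    unfolding dofs
    using card_Un_le[of "?V \<union> ?N \<union> ?T" "Interior ` BK"] card_Un_le[of "?V \<union> ?N" ?T] card_Un_le[of ?V ?N] by linarith
qed

lemma edge_of_KE:
  assumes "e edge_of K"
  obtains x y where "e = closed_segment x y" "e \<subseteq> K"
  using assms edge_of_imp_subset[OF assms] unfolding edge_of_K_iff by blast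

text \<open>Test functions are continuous on their edge or on \<open>K\<close>, and so are the
  fields; this supplies the integrability behind additivity of the integrals.\<close>

lemma linear_dof_eval:
  assumes "\<And>e. e edge_of K \<Longrightarrow> B1 e \<subseteq> poly_space 1 e UNIV" and "\<And>e. e edge_of K \<Longrightarrow> B0 e \<subseteq> poly_space 0 e UNIV"
    and "BK \<subseteq> poly_space 0 K sym_mats" and d: "d \<in> dofs K B1 B0 BK"
  shows "linear (\<lambda>C. dof_eval K n t d (cubic_field_on a b c C))"
proof -
  note lin = linear_cubic_field_on_apply[of a b c]
  have edge: "linear (\<lambda>C. edge_integral e (\<lambda>x. (w \<bullet> (cubic_field_on a b c C x *v m)) * q x))"
    if e: "e edge_of K" and q: "continuous_on e q" for e w m q
  proof -
    obtain x y where xy: "e = closed_segment x y" "e \<subseteq> K" using e by (rule edge_of_KE)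
    show ?thesis
      unfolding xy(1)
    proof (rule linear_edge_integral)
      show "continuous_on (closed_segment x y) (\<lambda>x. (w \<bullet> (cubic_field_on a b c C x *v m)) * q x)" for C
        using q xy by (intro continuous_on_mult continuous_on_quadratic_form continuous_on_cubic_field_on) auto
      show "linear (\<lambda>C. (w \<bullet> (cubic_field_on a b c C x *v m)) * q x)" for x
        by (rule linearI)
          (simp_all add: linear_add[OF lin] linear_scale[OF lin] matrix_vector_mult_add_rdistrib inner_add_right
            distrib_right scaleR_matrix_vector_assoc[symmetric])
    qed
  qed
  from d consider v i j where "d = Vertex_value v (i, j)" | e q where "d = Edge_nn e q" "e edge_of K" "q \<in> B1 e"
    | e q where "d = Edge_tn e q" "e edge_of K" "q \<in> B0 e" | q where "d = Interior q" "q \<in> BK"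
    unfolding dofs_def by blast
  then show ?thesis
  proof cases
    case 1
    show ?thesis unfolding 1 dof_eval.simps
      by (rule linearI) (simp_all add: linear_add[OF lin] linear_scale[OF lin])
  next
    case 2
    then have "continuous_on e q" using assms(1) continuous_on_poly_space by blast
    with 2 edge show ?thesis by simp
  next
    case 3
    then have "continuous_on e q" using assms(2) continuous_on_poly_space by blast
    with 3 edge show ?thesis by simp
  next
    case 4
    then obtain S where "q = restr K (\<lambda>_. S)" using assms(3) poly_space_0 by blast
    then have q: "continuous_on K q" using continuous_on_restr[of K "\<lambda>_. S"] by simp
    show ?thesis
      unfolding 4 dof_eval.simps
    proof (rule linear_integral_compact[OF compact_K])
      show "continuous_on K (\<lambda>x. cubic_field_on a b c C x \<bullet> q x)" for C
        by (intro continuous_on_inner continuous_on_cubic_field_on q order_refl)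
      show "linear (\<lambda>C. cubic_field_on a b c C x \<bullet> q x)" for x
        by (rule linearI) (simp_all add: linear_add[OF lin] linear_scale[OF lin] inner_add_left)
    qed
  qed
qed

lemma dofs_separating:
  assumes n: "\<And>e. e edge_of K \<Longrightarrow> unit_normal e (n e)" and t: "\<And>e. e edge_of K \<Longrightarrow> unit_tangent e (t e)"
    and B1: "\<And>e. e edge_of K \<Longrightarrow> basis_of (B1 e) (poly_space 1 e UNIV)"
    and B0: "\<And>e. e edge_of K \<Longrightarrow> basis_of (B0 e) (poly_space 0 e UNIV)"
    and BK: "basis_of BK (poly_space 0 K sym_mats)"
    and C: "constraint a b c C = 0"
    and 0: "\<And>d. d \<in> dofs K B1 B0 BK \<Longrightarrow> dof_eval K n t d (cubic_field_on a b c C) = 0"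
  shows "C = 0"
proof -
  interpret rot: triangle b c a by (rule rotate)
  interpret rot': triangle c a b by (rule rot.rotate)
  obtain p q r where pqr: "C = (p, q, r)" by (metis prod.exhaust)
  define F where "F = cubic_field a b c p q r"
  have on: "cubic_field_on a b c C = restr K F" by (simp add: cubic_field_on_def pqr F_def)
  have cont: "continuous_on A F" for A unfolding F_def by (rule continuous_on_cubic_field)
  have cont': "continuous_on A (restr K F)" if "A \<subseteq> K" for A
    using continuous_on_subset[OF continuous_on_restr[OF cont]] that .
  have vertex: "F v = 0" if v: "v \<in> {a, b, c}" for v
  proof -
    have vK: "v \<in> K" using v by auto
    have "F v $ i $ j = 0" if "(i, j) \<in> {(1, 1), (1, 2), (2, 2)}" for i j
      using 0[of "Vertex_value v (i, j)"] v that vK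
      unfolding dofs_def extreme_point_of_K_iff on by (auto simp: restr_def)
    \<comment> \<open>Only three entries are prescribed; the fourth follows because every
      \<open>outer u\<close> is symmetric.\<close>
    moreover have "F v $ 2 $ 1 = F v $ 1 $ 2" by (simp add: F_def cubic_field_def)
    ultimately show ?thesis by (simp add: vec_eq_iff forall_2)
  qed
  have nn: "edge_integral e (\<lambda>x. (n e \<bullet> (restr K F x *v n e)) * restr e g x) = 0"
    if e: "e edge_of K" and g: "g \<in> polyfun2 1" for e g
  proof -
    obtain x y where xy: "e = closed_segment x y" "e \<subseteq> K" using e by (rule edge_of_KE)
    have "restr e g \<in> span (B1 e)" using B1[OF e] g unfolding basis_of_def poly_space_UNIV_real by blast
    moreover have "edge_integral e (\<lambda>x. (n e \<bullet> (restr K F x *v n e)) * q x) = 0" if "q \<in> B1 e" for q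
      using 0[of "Edge_nn e q"] that e unfolding dofs_def on by auto
    moreover have "continuous_on e q" if "q \<in> B1 e" for q
      using that basis_of_subset[OF B1[OF e]] continuous_on_poly_space by blast
    ultimately show ?thesis
      using edge_integral_eq_0_span[of x y "\<lambda>x. n e \<bullet> (restr K F x *v n e)" "B1 e" "restr e g"]
        continuous_on_quadratic_form[OF cont'[OF xy(2)]] unfolding xy(1) by blast
  qed
  have tn: "edge_integral e (\<lambda>x. (t e \<bullet> (restr K F x *v n e)) * restr e (\<lambda>_. 1) x) = 0"
    if e: "e edge_of K" for e
  proof -
    obtain x y where xy: "e = closed_segment x y" "e \<subseteq> K" using e by (rule edge_of_KE)
    have "restr e (\<lambda>_. 1) \<in> poly_space 0 e (UNIV :: real set)" unfolding poly_space_0 by blast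
    then have "restr e (\<lambda>_. 1) \<in> span (B0 e)" using B0[OF e] unfolding basis_of_def by blast
    moreover have "edge_integral e (\<lambda>x. (t e \<bullet> (restr K F x *v n e)) * q x) = 0" if "q \<in> B0 e" for q
      using 0[of "Edge_tn e q"] that e unfolding dofs_def on by auto
    moreover have "continuous_on e q" if "q \<in> B0 e" for q
      using that basis_of_subset[OF B0[OF e]] continuous_on_poly_space by blast
    ultimately show ?thesis
      using edge_integral_eq_0_span[of x y "\<lambda>x. t e \<bullet> (restr K F x *v n e)" "B0 e" "restr e (\<lambda>_. 1)"]
        continuous_on_quadratic_form[OF cont'[OF xy(2)]] unfolding xy(1) by blast
  qed
  have moments: "integral K (\<lambda>x. restr K F x \<bullet> restr K (\<lambda>_. S) x) = 0" if S: "S \<in> sym_mats" for S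
  proof (rule integral_inner_eq_0_span[OF compact_K cont'[OF order_refl]])
    have "restr K (\<lambda>_. S) \<in> poly_space 0 K sym_mats" unfolding poly_space_0 using S by blast
    then show "restr K (\<lambda>_. S) \<in> span BK" using BK unfolding basis_of_def by blast
    fix q assume q: "q \<in> BK"
    then obtain S where "q = restr K (\<lambda>_. S)" using basis_of_subset[OF BK] poly_space_0 by blast
    then show "continuous_on K q" using continuous_on_restr[of K "\<lambda>_. S"] by simp
    show "integral K (\<lambda>x. restr K F x \<bullet> q x) = 0"
      using 0[of "Interior q"] q unfolding dofs_def on by auto
  qed
  have e: "closed_segment a b edge_of K" "closed_segment b c edge_of K" "closed_segment c a edge_of K"
    unfolding edge_of_K_iff by auto
  have hull: "convex hull {b, c, a} = K" "convex hull {c, a, b} = K" by (simp_all add: insert_commute)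
  have F1: "cubic_field b c a (rot_cubic q) (rot_cubic r) (rot_cubic p) = F"
    and F2: "cubic_field c a b (rot_cubic (rot_cubic r)) (rot_cubic (rot_cubic p)) (rot_cubic (rot_cubic q)) = F"
    by (simp_all add: cubic_field_rotate F_def)
  have coeff: "edge_coeff a b c p q = 0" "edge_coeff b c a (rot_cubic q) (rot_cubic r) = 0"
    "edge_coeff c a b (rot_cubic (rot_cubic r)) (rot_cubic (rot_cubic p)) = 0"
    and div: "div_coeffs (p, q, r) 1 (-1) 0 = 0" "div_coeffs (p, q, r) 0 1 (-1) = 0" "div_coeffs (p, q, r) 1 0 (-1) = 0"
    using C by (simp_all add: constraint_def pqr zero_prod_def)
  have v: "F a = 0" "F b = 0" "F c = 0" using vertex by auto
  note edge = edge_separation[OF n[OF e(1)] t[OF e(1)] coeff(1), of r, folded F_def, OF v(1,2) nn[OF e(1)] tn[OF e(1)]]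
  note edge' = rot.edge_separation[OF n[OF e(2)] t[OF e(2)] coeff(2), of "rot_cubic p", unfolded hull F1 cub_rot_cubic,
    OF v(2,3) nn[OF e(2)] tn[OF e(2)]]
  note edge'' = rot'.edge_separation[OF n[OF e(3)] t[OF e(3)] coeff(3), of "rot_cubic (rot_cubic q)",
    unfolded hull F2 cub_rot_cubic, OF v(3,1) nn[OF e(3)] tn[OF e(3)]]
  have "tri_integral a b c (cub p) = 0"
    using tri_integral_eq_0_if_moments_eq_0 moments unfolding F_def by blast
  moreover have "tri_integral a b c (cub q) = 0"
    using rot.tri_integral_eq_0_if_moments_eq_0[of "rot_cubic q" "rot_cubic r" "rot_cubic p", unfolded hull F1 tri_integral_rot_cubic]
      moments by blast
  moreover have "tri_integral a b c (cub r) = 0"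
    using rot'.tri_integral_eq_0_if_moments_eq_0[of "rot_cubic (rot_cubic r)" "rot_cubic (rot_cubic p)" "rot_cubic (rot_cubic q)",
      unfolded hull F2 tri_integral_rot_cubic] moments by blast
  ultimately have "p = 0 \<and> q = 0 \<and> r = 0"
    using edge edge' edge'' div by (intro cubic_separation)
  then show "C = 0" by (simp add: pqr zero_prod_def)
qed

end

lemma triangle_if_2_simplex:
  assumes "2 simplex K"
  obtains a b c where "triangle a b c" "K = convex hull {a, b, c}"
proof -
  from assms obtain S where S: "\<not> affine_dependent S" "int (card S) = 2 + 1" "K = convex hull S"
    unfolding simplex_def by blast
  then have "card S = 3" by simp
  then obtain a b c where abc: "S = {a, b, c}" "a \<noteq> b" "b \<noteq> c" "a \<noteq> c" by (auto simp: card_3_iff)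
  have "cross2 (b - a) (c - a) \<noteq> 0"
  proof
    assume 0: "cross2 (b - a) (c - a) = 0"
    have "collinear {a, b, c}"
      unfolding collinear_def
    proof (intro exI[of _ "b - a"] ballI)
      have "b - a \<noteq> 0" using abc(2) by simp
      \<comment> \<open>A coordinate in which b - a is nonzero fixes the factor k; the vanishing of
        \<open>cross2\<close> makes it valid in the other coordinate too.\<close>
      then obtain i where i: "(b - a) $ i \<noteq> 0" unfolding vec_eq_iff by auto
      define k where "k = (c - a) $ i / (b - a) $ i"
      have "(c - a) $ j * (b - a) $ i = (c - a) $ i * (b - a) $ j" for j
        using 0 exhaust_2[of i] exhaust_2[of j] by (auto simp: cross2_def algebra_simps)
      then have "(c - a) $ j = k * (b - a) $ j" for j
        using i by (simp add: k_def nonzero_eq_divide_eq del: vector_minus_component)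
      then have c: "c - a = k *\<^sub>R (b - a)" by (simp add: vec_eq_iff)
      fix x y assume xy: "x \<in> {a, b, c}" "y \<in> {a, b, c}"
      have "\<exists>k. z = a + k *\<^sub>R (b - a)" if "z \<in> {a, b, c}" for z
        using that c by (auto intro: exI[of _ 0] exI[of _ 1] exI[of _ k] simp: algebra_simps)
      then obtain l m where lm: "x = a + l *\<^sub>R (b - a)" "y = a + m *\<^sub>R (b - a)" using xy by meson
      have "x - y = (l - m) *\<^sub>R (b - a)" unfolding lm by (simp add: algebra_simps)
      then show "\<exists>k. x - y = k *\<^sub>R (b - a)" by blast
    qed
    then show False using S(1) abc collinear_3_eq_affine_dependent by blast
  qed
  then show thesis using that[of a b c] S(3) abc(1) by (simp add: triangle_def)
qed

theorem lemma2p2: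
  fixes K :: "(real^2) set"
    and n t :: "(real^2) set \<Rightarrow> real^2"
    and B1 B0 :: "(real^2) set \<Rightarrow> (real^2 \<Rightarrow> real) set"
    and BK :: "(real^2 \<Rightarrow> real^2^2) set"
  assumes "2 simplex K"
    and "\<And>e. e edge_of K \<Longrightarrow> unit_normal e (n e)"
    and "\<And>e. e edge_of K \<Longrightarrow> unit_tangent e (t e)"
    and "\<And>e. e edge_of K \<Longrightarrow> basis_of (B1 e) (poly_space 1 e UNIV)"
    and "\<And>e. e edge_of K \<Longrightarrow> basis_of (B0 e) (poly_space 0 e UNIV)"
    and "basis_of BK (poly_space 0 K sym_mats)"
  shows "unisolvent (Sigma_space K) (dofs K B1 B0 BK) (dof_eval K n t)"
proof -
  obtain a b c where "triangle a b c" and K: "K = convex hull {a, b, c}"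
    using triangle_if_2_simplex[OF assms(1)] by blast
  then interpret triangle a b c by simp
  note assms = assms[unfolded K]
  show ?thesis
    unfolding K
  proof (rule unisolvent_if_separating[OF linear_constraint _ linear_cubic_field_on Sigma_space_K])
    show "finite (dofs (convex hull {a, b, c}) B1 B0 BK)"
      by (rule finite_card_dofs[OF assms(4-6)])
    show "linear (\<lambda>C. dof_eval (convex hull {a, b, c}) n t d (cubic_field_on a b c C))"
      if "d \<in> dofs (convex hull {a, b, c}) B1 B0 BK" for d
      by (rule linear_dof_eval[OF _ _ _ that]) (intro basis_of_subset assms; assumption)+
    show "C = 0" if "constraint a b c C = 0"
      "\<And>d. d \<in> dofs (convex hull {a, b, c}) B1 B0 BK \<Longrightarrow> dof_eval (convex hull {a, b, c}) n t d (cubic_field_on a b c C) = 0" for C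
      using dofs_separating[OF assms(2-6) that] .
    \<comment> \<open>Nine constraints and at most 21 functionals against three cubics with ten
      coefficients each.\<close>
    show "DIM(((real \<times> real) \<times> (real \<times> real) \<times> (real \<times> real)) \<times> real \<times> real \<times> real)
      + card (dofs (convex hull {a, b, c}) B1 B0 BK) \<le> DIM(cubic \<times> cubic \<times> cubic)"
      using finite_card_dofs(2)[OF assms(4-6)] by simp
  qed
qed

end
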